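(* Let $(X,G,\Phi)$ be a minimal equicontinuous action of a finitely generated infinite group $G$ on a Cantor set $X$, let $x\in X$, and let $\{G_i\}_{i\ge 0}$ be a group chain with basepoint $x$ associated to the action, with limit core $C_\infty$ and discriminant group $\mathcal{D}_x\subset C_\infty$. Then there is a natural isomorphism of topological groups $\overline{\Phi(G)}\cong C_\infty$ which restricts to an isomorphism $\overline{\Phi(G)}_x\cong\mathcal{D}_x$.
   Context: $\Phi\colon G\times X\to X$ is an action by homeomorphisms; write $g\cdot x=\Phi(g)(x)$. The action is minimal if every orbit is dense, and equicontinuous (with respect to a metric $d$ on $X$) if for all $\varepsilon>0$ there is $\delta>0$ such that $d(u,v)<\delta$ implies $d(g\cdot u,g\cdot v)<\varepsilon$ for all $u,v\in X$, $g\in G$. $\overline{\Phi(G)}$ is the closure of $\Phi(G)\subset \mathrm{Homeo}(X)$ in the uniform topology; it is a compact topological group acting transitively on $X$. Its isotropy group at $x$ is $\overline{\Phi(G)}_x=\{\hat g\in\overline{\Phi(G)}\mid \hat g(x)=x\}$. A group chain in $G$ is a properly descending chain $G=G_0\supset G_1\supset G_2\supset\cdots$ of subgroups of finite index. A group chain associated to $(X,G,\Phi)$ with basepoint $x$ (and partitions $\{\mathcal{P}_i\}_{i\ge0}$) is obtained from clopen sets $X=V_0\supset V_1\supset V_2\supset\cdots$ with $\bigcap_i V_i=\{x\}$ such that each $\mathcal{P}_i=\{g\cdot V_i\}_{g\in G}$ is a finite partition of $X$ and $\mathrm{diam}(g\cdot V_i)<2^{-i}$ for all $g\in G$, $i\ge1$,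 by setting $G_i=\{g\in G\mid g\cdot V_i=V_i\}$. Such chains always exist. For a group chain $\{G_i\}$, let $C_i=\bigcap_{g\in G}gG_ig^{-1}$. The limit core is the profinite group $C_\infty=\varprojlim\{G/C_{i+1}\to G/C_i\}$ and the discriminant group is the profinite group $\mathcal{D}_x=\varprojlim\{G_{i+1}/C_{i+1}\to G_i/C_i\}\subset C_\infty$, with bonding maps induced by inclusion of cosets. "Natural" means that the isomorphism is the one induced by the quotient maps $G\to G/C_i$, i.e. $\Phi(g)\mapsto(gC_i)_i$ for $g\in G$. *)

theory Defs
  imports "HOL-Analysis.Analysis" "HOL-Algebra.Product_Groups" "HOL-Algebra.Group_Action"
    "HOL-Algebra.Generated_Groups"
begin

definition topological_group :: "('a, 'r) monoid_scheme \<Rightarrow> 'a topology \<Rightarrow> bool" where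
  "topological_group G T \<longleftrightarrow>
     group G \<and> topspace T = carrier G \<and>
     continuous_map (prod_topology T T) T (\<lambda>(a, b). a \<otimes>\<^bsub>G\<^esub> b) \<and>
     continuous_map T T (\<lambda>a. inv\<^bsub>G\<^esub> a)"

definition topological_group_iso ::
    "('a, 'r) monoid_scheme \<Rightarrow> 'a topology \<Rightarrow> ('b, 's) monoid_scheme \<Rightarrow> 'b topology
      \<Rightarrow> ('a \<Rightarrow> 'b) \<Rightarrow> bool" where
  "topological_group_iso G S H T f \<longleftrightarrow>
     topological_group G S \<and> topological_group H T \<and> f \<in> iso G H \<and> homeomorphic_map S T f"

definition finitely_generated_group :: "('a, 'r) monoid_scheme \<Rightarrow> bool" where
  "finitely_generated_group G \<longleftrightarrow>
     group G \<and> (\<exists>S. finite S \<and> S \<subseteq> carrier G \<and> generate G S = carrier G)"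


definition cantor_topology :: "(nat \<Rightarrow> bool) topology" where
  "cantor_topology = product_topology (\<lambda>_. discrete_topology UNIV) UNIV"

definition cantor_set :: "'a metric \<Rightarrow> bool" where
  "cantor_set m \<longleftrightarrow> mtopology_of m homeomorphic_space cantor_topology"

definition mdiameter :: "'a metric \<Rightarrow> 'a set \<Rightarrow> real" where
  "mdiameter m S = (if S = {} then 0 else SUP (u, v) \<in> S \<times> S. mdist m u v)"

text \<open>As in \<^const>\<open>BijGroup\<close>, homeomorphisms of the carrier are represented by extensional
  functions, so that each of them is represented exactly once.\<close>

definition Homeo :: "'a metric \<Rightarrow> ('a \<Rightarrow> 'a) monoid" where
  "Homeo m = (BijGroup (mspace m))
     \<lparr>carrier := {f \<in> Bij (mspace m). homeomorphic_map (mtopology_of m) (mtopology_of m) f}\<rparr>"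

text \<open>The supremum metric is totalised by 0 because \<^locale>\<open>Metric_space\<close> demands nonnegativity
  also for arguments outside the carrier. The supremum is finite when the space is compact.\<close>

definition uniform_dist :: "'a metric \<Rightarrow> ('a \<Rightarrow> 'a) \<Rightarrow> ('a \<Rightarrow> 'a) \<Rightarrow> real" where
  "uniform_dist m f g =
     (if f \<in> carrier (Homeo m) \<and> g \<in> carrier (Homeo m)
      then SUP u \<in> mspace m. mdist m (f u) (g u) else 0)"

definition uniform_topology :: "'a metric \<Rightarrow> ('a \<Rightarrow> 'a) topology" where
  "uniform_topology m = Metric_space.mtopology (carrier (Homeo m)) (uniform_dist m)"


definition action_by_homeos ::
    "'a metric \<Rightarrow> ('g, 'r) monoid_scheme \<Rightarrow> ('g \<Rightarrow> 'a \<Rightarrow> 'a) \<Rightarrow> bool" where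
  "action_by_homeos m G \<Phi> \<longleftrightarrow>
     group_action G (mspace m) \<Phi> \<and>
     (\<forall>g \<in> carrier G. homeomorphic_map (mtopology_of m) (mtopology_of m) (\<Phi> g))"

definition minimal_action ::
    "'a metric \<Rightarrow> ('g, 'r) monoid_scheme \<Rightarrow> ('g \<Rightarrow> 'a \<Rightarrow> 'a) \<Rightarrow> bool" where
  "minimal_action m G \<Phi> \<longleftrightarrow>
     (\<forall>u \<in> mspace m. mtopology_of m closure_of (orbit G \<Phi> u) = mspace m)"

definition equicontinuous_action ::
    "'a metric \<Rightarrow> ('g, 'r) monoid_scheme \<Rightarrow> ('g \<Rightarrow> 'a \<Rightarrow> 'a) \<Rightarrow> bool" where
  "equicontinuous_action m G \<Phi> \<longleftrightarrow>
     (\<forall>\<epsilon>>0. \<exists>\<delta>>0. \<forall>u \<in> mspace m. \<forall>v \<in> mspace m. \<forall>g \<in> carrier G.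
        mdist m u v < \<delta> \<longrightarrow> mdist m (\<Phi> g u) (\<Phi> g v) < \<epsilon>)"

definition closure_group ::
    "'a metric \<Rightarrow> ('g, 'r) monoid_scheme \<Rightarrow> ('g \<Rightarrow> 'a \<Rightarrow> 'a) \<Rightarrow> ('a \<Rightarrow> 'a) monoid" where
  "closure_group m G \<Phi> = (Homeo m)
     \<lparr>carrier := uniform_topology m closure_of (\<Phi> ` carrier G)\<rparr>"

definition isotropy_group ::
    "'a metric \<Rightarrow> ('g, 'r) monoid_scheme \<Rightarrow> ('g \<Rightarrow> 'a \<Rightarrow> 'a) \<Rightarrow> 'a \<Rightarrow> ('a \<Rightarrow> 'a) monoid" where
  "isotropy_group m G \<Phi> x = (Homeo m)
     \<lparr>carrier := {f \<in> carrier (closure_group m G \<Phi>). f x = x}\<rparr>"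


definition group_chain :: "('g, 'r) monoid_scheme \<Rightarrow> (nat \<Rightarrow> 'g set) \<Rightarrow> bool" where
  "group_chain G Gs \<longleftrightarrow>
     Gs 0 = carrier G \<and>
     (\<forall>i. subgroup (Gs i) G \<and> finite (rcosets\<^bsub>G\<^esub> (Gs i)) \<and> Gs (Suc i) \<subset> Gs i)"

definition associated_group_chain ::
    "'a metric \<Rightarrow> ('g, 'r) monoid_scheme \<Rightarrow> ('g \<Rightarrow> 'a \<Rightarrow> 'a) \<Rightarrow> 'a \<Rightarrow> (nat \<Rightarrow> 'g set) \<Rightarrow> bool" where
  "associated_group_chain m G \<Phi> x Gs \<longleftrightarrow>
     group_chain G Gs \<and>
     (\<exists>V :: nat \<Rightarrow> 'a set.
        V 0 = mspace m \<and>
        (\<forall>i. V (Suc i) \<subseteq> V i) \<and>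
        (\<forall>i. openin (mtopology_of m) (V i) \<and> closedin (mtopology_of m) (V i)) \<and>
        (\<Inter>i. V i) = {x} \<and>
        (\<forall>i. finite ((\<lambda>g. \<Phi> g ` V i) ` carrier G) \<and>
             partition_on (mspace m) ((\<lambda>g. \<Phi> g ` V i) ` carrier G)) \<and>
        (\<forall>i\<ge>1. \<forall>g \<in> carrier G. mdiameter m (\<Phi> g ` V i) < (1/2) ^ i) \<and>
        (\<forall>i. Gs i = {g \<in> carrier G. \<Phi> g ` V i = V i}))"

definition chain_core :: "('g, 'r) monoid_scheme \<Rightarrow> (nat \<Rightarrow> 'g set) \<Rightarrow> nat \<Rightarrow> 'g set" where
  "chain_core G Gs i = (\<Inter>g \<in> carrier G. (g <#\<^bsub>G\<^esub> Gs i) #>\<^bsub>G\<^esub> (inv\<^bsub>G\<^esub> g))"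


definition inverse_limit ::
    "(nat \<Rightarrow> ('a, 'r) monoid_scheme) \<Rightarrow> (nat \<Rightarrow> 'a \<Rightarrow> 'a) \<Rightarrow> (nat \<Rightarrow> 'a) monoid" where
  "inverse_limit Q p = (product_group UNIV Q)
     \<lparr>carrier := {s \<in> carrier (product_group UNIV Q). \<forall>i. p i (s (Suc i)) = s i}\<rparr>"

definition inverse_limit_topology ::
    "(nat \<Rightarrow> ('a, 'r) monoid_scheme) \<Rightarrow> (nat \<Rightarrow> 'a \<Rightarrow> 'a) \<Rightarrow> (nat \<Rightarrow> 'a) topology" where
  "inverse_limit_topology Q p =
     subtopology (product_topology (\<lambda>i. discrete_topology (carrier (Q i))) UNIV)
       (carrier (inverse_limit Q p))"

text \<open>The elements of the quotient groups are cosets. The bonding map into \<open>Q\<close> sends a coset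
  to the unique coset in \<open>Q\<close> that contains it.\<close>

definition coset_bond :: "('g set, 'r) monoid_scheme \<Rightarrow> 'g set \<Rightarrow> 'g set" where
  "coset_bond Q A = (THE B. B \<in> carrier Q \<and> A \<subseteq> B)"

definition limit_core_quotient ::
    "('g, 'r) monoid_scheme \<Rightarrow> (nat \<Rightarrow> 'g set) \<Rightarrow> nat \<Rightarrow> 'g set monoid" where
  "limit_core_quotient G Gs i = G Mod (chain_core G Gs i)"

definition limit_core ::
    "('g, 'r) monoid_scheme \<Rightarrow> (nat \<Rightarrow> 'g set) \<Rightarrow> (nat \<Rightarrow> 'g set) monoid" where
  "limit_core G Gs =
     inverse_limit (limit_core_quotient G Gs) (\<lambda>i. coset_bond (limit_core_quotient G Gs i))"

definition limit_core_topology ::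
    "('g, 'r) monoid_scheme \<Rightarrow> (nat \<Rightarrow> 'g set) \<Rightarrow> (nat \<Rightarrow> 'g set) topology" where
  "limit_core_topology G Gs =
     inverse_limit_topology (limit_core_quotient G Gs)
       (\<lambda>i. coset_bond (limit_core_quotient G Gs i))"

definition discriminant_quotient ::
    "('g, 'r) monoid_scheme \<Rightarrow> (nat \<Rightarrow> 'g set) \<Rightarrow> nat \<Rightarrow> 'g set monoid" where
  "discriminant_quotient G Gs i = (G\<lparr>carrier := Gs i\<rparr>) Mod (chain_core G Gs i)"

definition discriminant_group ::
    "('g, 'r) monoid_scheme \<Rightarrow> (nat \<Rightarrow> 'g set) \<Rightarrow> (nat \<Rightarrow> 'g set) monoid" where
  "discriminant_group G Gs =
     inverse_limit (discriminant_quotient G Gs) (\<lambda>i. coset_bond (discriminant_quotient G Gs i))"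

definition discriminant_topology ::
    "('g, 'r) monoid_scheme \<Rightarrow> (nat \<Rightarrow> 'g set) \<Rightarrow> (nat \<Rightarrow> 'g set) topology" where
  "discriminant_topology G Gs =
     inverse_limit_topology (discriminant_quotient G Gs)
       (\<lambda>i. coset_bond (discriminant_quotient G Gs i))"

end

(* The partitions into translates of V_i define G-invariant equivalence relations R i on X whose
classes are uniformly open and have diameters tending to 0. So a map f lies in the closure of
Phi(G) iff for every i some g in G satisfies R i (f u) (g u) for all u; the set of these g is a
coset of the core C_i, since C_i consists of the g with R i (g u) u for all u. Sending f to this
sequence of cosets is the isomorphism. It is onto by compactness: for a compatible sequence of
cosets g_i C_i the classes of g_i u form a decreasing sequence of nonempty closed sets, which meet
in one point f u, and the inverses of the g_i yield the inverse of f. Finally f fixes x iff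
R i (g x) x, that is g in G_i, for all i and all g in the i-th coset. *)
theory Submission
  imports Defs
begin

section \<open>Inverse limits of discrete groups\<close>

text \<open>The obstacle is the uniform topology: continuity of composition and inversion, and of
  the isomorphism in both directions, would call for separate estimates. One comparison replaces
  them all: small uniform distance forces agreement up to \<open>R i\<close>, and agreement up to
  \<open>R i\<close> for a suitable \<open>i\<close> forces small uniform distance. Hence a set of
  maps in the closure is open iff with each member it contains all maps with the same coset at some
  single index. The inverse limit topology has the same description, because a coordinate determines
  all lower ones. So the bijection matches open sets literally, and the closure inherits its
  topological group structure from the limit core. A uniform limit of homeomorphisms need not be
  bijective in general, which is why an inverse has to be built alongside \<open>f\<close>. Uniform
  openness of the classes comes from a Lebesgue number of the partition. The discriminant group
  consists of sequences of the very same cosets, so the second isomorphism is a restriction of the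
  first.\<close>

lemma mem_inverse_limit_iff:
  "s \<in> carrier (inverse_limit Q p) \<longleftrightarrow> (\<forall>i. s i \<in> carrier (Q i) \<and> p i (s (Suc i)) = s i)"
  by (auto simp: inverse_limit_def)

lemma mult_inverse_limit [simp]:
  "s \<otimes>\<^bsub>inverse_limit Q p\<^esub> t = (\<lambda>i. s i \<otimes>\<^bsub>Q i\<^esub> t i)"
  by (simp add: inverse_limit_def restrict_UNIV)

lemma topspace_inverse_limit_topology [simp]:
  "topspace (inverse_limit_topology Q p) = carrier (inverse_limit Q p)"
  by (auto simp: inverse_limit_topology_def mem_inverse_limit_iff)

text \<open>Bonding maps compute each coordinate from the next one, so a coordinate determines all
  lower ones. This lets a single index do the work of finitely many.\<close>

lemma inverse_limit_eq_below:
  assumes "s \<in> carrier (inverse_limit Q p)" "t \<in> carrier (inverse_limit Q p)"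
    and "i \<le> j" "s j = t j"
  shows "s i = t i"
  using assms(3,4)
proof (induction rule: inc_induct)
  case (step n)
  then show ?case
    using assms(1,2) by (metis mem_inverse_limit_iff)
qed

text \<open>A basic open set of the product restricts finitely many coordinates only, and the
  largest of these controls the others. So cylinders over one coordinate form a base.\<close>

lemma openin_inverse_limit_topology:
  "openin (inverse_limit_topology Q p) U \<longleftrightarrow>
     U \<subseteq> carrier (inverse_limit Q p) \<and>
     (\<forall>s\<in>U. \<exists>i. \<forall>t\<in>carrier (inverse_limit Q p). t i = s i \<longrightarrow> t \<in> U)"
    (is "_ \<longleftrightarrow> ?C U")
proof
  let ?P = "product_topology (\<lambda>i. discrete_topology (carrier (Q i))) UNIV"
  let ?L = "carrier (inverse_limit Q p)"
  assume "openin (inverse_limit_topology Q p) U"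
  then obtain W where W: "openin ?P W" and U: "U = W \<inter> ?L"
    by (auto simp: inverse_limit_topology_def openin_subtopology)
  have "\<exists>i. \<forall>t\<in>?L. t i = s i \<longrightarrow> t \<in> U" if s: "s \<in> U" for s
  proof -
    obtain V where fin: "finite {i. V i \<noteq> carrier (Q i)}" and sV: "s \<in> Pi\<^sub>E UNIV V"
      and VW: "Pi\<^sub>E UNIV V \<subseteq> W"
      using W s U by (auto simp: openin_product_topology_alt)
    \<comment> \<open>\<open>j\<close> bounds the restricted coordinates; agreement at
      \<open>j\<close> settles all of them.\<close>
    obtain j where j: "\<And>i. V i \<noteq> carrier (Q i) \<Longrightarrow> i \<le> j"
      using fin by (auto simp: finite_nat_set_iff_bounded_le)
    have "t \<in> U" if t: "t \<in> ?L" and eq: "t j = s j" for t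
    proof -
      have "t i \<in> V i" for i
      proof (cases "V i = carrier (Q i)")
        case True
        then show ?thesis
          using t by (auto simp: mem_inverse_limit_iff)
      next
        case False
        then have "t i = s i"
          using inverse_limit_eq_below[OF t, of s i j] j eq s U by blast
        then show ?thesis
          using sV by (auto simp: PiE_iff)
      qed
      then show ?thesis
        using VW t U by auto
    qed
    then show ?thesis by blast
  qed
  then show "?C U"
    using U by blast
next
  let ?P = "product_topology (\<lambda>i. discrete_topology (carrier (Q i))) UNIV"
  let ?L = "carrier (inverse_limit Q p)"
  assume C: "?C U"
  have op: "openin (inverse_limit_topology Q p) {t \<in> ?L. t i = s i}" if "s \<in> ?L" for s i
  proof -
    have "continuous_map ?P (discrete_topology (carrier (Q i))) (\<lambda>t. t i)"
      by (rule continuous_map_product_projection) simp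
    then have "openin ?P {t \<in> topspace ?P. t i \<in> {s i}}"
      using that by (intro openin_continuous_map_preimage) (auto simp: mem_inverse_limit_iff)
    moreover have "{t \<in> ?L. t i = s i} = {t \<in> topspace ?P. t i \<in> {s i}} \<inter> ?L"
      by (auto simp: mem_inverse_limit_iff)
    ultimately show ?thesis
      unfolding inverse_limit_topology_def openin_subtopology by blast
  qed
  show "openin (inverse_limit_topology Q p) U"
    unfolding openin_subopen[of _ U]
  proof
    fix s assume s: "s \<in> U"
    then obtain i where "\<forall>t\<in>?L. t i = s i \<longrightarrow> t \<in> U"
      using C by blast
    with op[of s i] s C show "\<exists>T. openin (inverse_limit_topology Q p) T \<and> s \<in> T \<and> T \<subseteq> U"
      by (intro exI[of _ "{t \<in> ?L. t i = s i}"]) auto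
  qed
qed

lemma openin_inverse_limit_topologyD:
  assumes "openin (inverse_limit_topology Q p) U" "s \<in> U"
  obtains i where "\<And>t. \<lbrakk>t \<in> carrier (inverse_limit Q p); t i = s i\<rbrakk> \<Longrightarrow> t \<in> U"
  using assms unfolding openin_inverse_limit_topology by blast

lemma openin_cylinder:
  "openin (inverse_limit_topology Q p) {t \<in> carrier (inverse_limit Q p). t i = a}"
  unfolding openin_inverse_limit_topology by fastforce

text \<open>Openness was reduced to agreement at one coordinate, which mentions the groups
  \<open>Q i\<close> only through the limit itself. It thus suffices to compare the limits as
  sets.\<close>

lemma inverse_limit_topology_subset:
  assumes sub: "carrier (inverse_limit Q p) \<subseteq> carrier (inverse_limit Q' p')"
  shows "inverse_limit_topology Q p =
    subtopology (inverse_limit_topology Q' p') (carrier (inverse_limit Q p))"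
    (is "?T = subtopology ?T' ?L")
  unfolding topology_eq
proof (intro allI iffI)
  fix U assume U: "openin ?T U"
  define cyl where "cyl s i = {t \<in> carrier (inverse_limit Q' p'). t i = s i}" for s :: "nat \<Rightarrow> 'a" and i
  \<comment> \<open>The cylinders are taken in the larger limit, but selected by their trace on
    \<open>?L\<close>; their union is open there and cuts out exactly \<open>U\<close>.\<close>
  define \<W> where "\<W> = {cyl s i | s i. s \<in> U \<and> (\<forall>t\<in>?L. t i = s i \<longrightarrow> t \<in> U)}"
  have "openin ?T' (\<Union>\<W>)"
    by (rule openin_Union) (auto simp: \<W>_def cyl_def openin_cylinder)
  moreover have "U = \<Union>\<W> \<inter> ?L"
  proof
    show "U \<subseteq> \<Union>\<W> \<inter> ?L"
    proof
      fix s assume s: "s \<in> U"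
      then have sL: "s \<in> ?L"
        using openin_subset[OF U] by auto
      obtain i where "\<forall>t\<in>?L. t i = s i \<longrightarrow> t \<in> U"
        using U s unfolding openin_inverse_limit_topology by blast
      then have "cyl s i \<in> \<W>"
        using s unfolding \<W>_def by blast
      moreover have "s \<in> cyl s i"
        using sL sub by (auto simp: cyl_def)
      ultimately show "s \<in> \<Union>\<W> \<inter> ?L"
        using sL by blast
    qed
  qed (auto simp: \<W>_def cyl_def)
  ultimately show "openin (subtopology ?T' ?L) U"
    by (auto simp: openin_subtopology)
next
  fix U assume "openin (subtopology ?T' ?L) U"
  then obtain W where W: "openin ?T' W" and U: "U = W \<inter> ?L"
    by (auto simp: openin_subtopology)
  show "openin ?T U"
    unfolding openin_inverse_limit_topology
  proof (intro conjI ballI)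
    fix s assume "s \<in> U"
    then have "s \<in> W"
      using U by blast
    then obtain i where "\<forall>t\<in>carrier (inverse_limit Q' p'). t i = s i \<longrightarrow> t \<in> W"
      using W unfolding openin_inverse_limit_topology by blast
    then show "\<exists>i. \<forall>t\<in>?L. t i = s i \<longrightarrow> t \<in> U"
      using sub U by blast
  qed (use U in blast)
qed

lemma topological_group_inverse_limit:
  assumes grp: "\<And>i. group (Q i)" and hom: "\<And>i. p i \<in> hom (Q (Suc i)) (Q i)"
  shows "topological_group (inverse_limit Q p) (inverse_limit_topology Q p)"
proof -
  interpret P: group "product_group UNIV Q"
    using grp by simp
  let ?L = "carrier (inverse_limit Q p)" and ?T = "inverse_limit_topology Q p"
  have gh: "group_hom (Q (Suc i)) (Q i) (p i)" for i
    using grp hom by (simp add: group_hom_def group_hom_axioms_def)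
  have inv_P: "inv\<^bsub>product_group UNIV Q\<^esub> s = (\<lambda>i. inv\<^bsub>Q i\<^esub> s i)" if "s \<in> ?L" for s
    using that grp by (subst inv_product_group) (auto simp: mem_inverse_limit_iff)
  have sub: "subgroup ?L (product_group UNIV Q)"
  proof (rule P.subgroupI)
    show "?L \<subseteq> carrier (product_group UNIV Q)"
      by (auto simp: mem_inverse_limit_iff)
    have "(\<lambda>i. \<one>\<^bsub>Q i\<^esub>) \<in> ?L"
      using grp group_hom.hom_one[OF gh] by (simp add: mem_inverse_limit_iff group.is_monoid)
    then show "?L \<noteq> {}" by blast
    show "inv\<^bsub>product_group UNIV Q\<^esub> s \<in> ?L" if "s \<in> ?L" for s
      using that grp group_hom.hom_inv[OF gh]
      by (simp add: inv_P mem_inverse_limit_iff)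
    show "s \<otimes>\<^bsub>product_group UNIV Q\<^esub> t \<in> ?L" if "s \<in> ?L" "t \<in> ?L" for s t
      using that group_hom.hom_mult[OF gh] monoid.m_closed[OF group.is_monoid[OF grp]]
      by (simp add: mem_inverse_limit_iff)
  qed
  have L_eq: "inverse_limit Q p = product_group UNIV Q\<lparr>carrier := ?L\<rparr>"
    by (simp add: inverse_limit_def)
  have group_L: "group (inverse_limit Q p)"
    using P.subgroup_imp_group[OF sub] L_eq by simp
  interpret L: group "inverse_limit Q p"
    by (rule group_L)
  have inv_L: "inv\<^bsub>inverse_limit Q p\<^esub> s = (\<lambda>i. inv\<^bsub>Q i\<^esub> s i)" if "s \<in> ?L" for s
    using P.m_inv_consistent[OF sub that] inv_P[OF that] L_eq by simp
  have "continuous_map (prod_topology ?T ?T) ?T (\<lambda>(a, b). a \<otimes>\<^bsub>inverse_limit Q p\<^esub> b)"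
    unfolding continuous_map_def
  proof (intro conjI allI impI)
    show "(\<lambda>(a, b). a \<otimes>\<^bsub>inverse_limit Q p\<^esub> b) \<in> topspace (prod_topology ?T ?T) \<rightarrow> topspace ?T"
      using L.m_closed by auto
    fix U assume U: "openin ?T U"
    let ?S = "{z \<in> topspace (prod_topology ?T ?T).
      (case z of (a, b) \<Rightarrow> a \<otimes>\<^bsub>inverse_limit Q p\<^esub> b) \<in> U}"
    show "openin (prod_topology ?T ?T) ?S"
      unfolding openin_prod_topology_alt
    proof (intro allI impI)
      fix s t assume "(s, t) \<in> ?S"
      then have st: "s \<in> ?L" "t \<in> ?L" "(\<lambda>i. s i \<otimes>\<^bsub>Q i\<^esub> t i) \<in> U" by auto
      obtain i where i: "\<And>r. \<lbrakk>r \<in> ?L; r i = s i \<otimes>\<^bsub>Q i\<^esub> t i\<rbrakk> \<Longrightarrow> r \<in> U"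
        using openin_inverse_limit_topologyD[OF U st(3)] by blast
      let ?C = "\<lambda>s. {t \<in> ?L. t i = s i}"
      \<comment> \<open>Coordinate \<open>i\<close> of a product depends only on coordinate
        \<open>i\<close> of the factors.\<close>
      have "?C s \<times> ?C t \<subseteq> ?S"
        using i L.m_closed by auto
      then show "\<exists>U V. openin ?T U \<and> openin ?T V \<and> s \<in> U \<and> t \<in> V \<and> U \<times> V \<subseteq> ?S"
        using st openin_cylinder[of Q p i] by (intro exI[of _ "?C s"] exI[of _ "?C t"]) auto
    qed
  qed
  moreover have "continuous_map ?T ?T (\<lambda>a. inv\<^bsub>inverse_limit Q p\<^esub> a)"
    unfolding continuous_map_def
  proof (intro conjI allI impI)
    show "(\<lambda>a. inv\<^bsub>inverse_limit Q p\<^esub> a) \<in> topspace ?T \<rightarrow> topspace ?T"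
      by simp
    fix U assume U: "openin ?T U"
    show "openin ?T {s \<in> topspace ?T. inv\<^bsub>inverse_limit Q p\<^esub> s \<in> U}"
      unfolding openin_inverse_limit_topology
    proof (intro conjI ballI)
      fix s assume "s \<in> {s \<in> topspace ?T. inv\<^bsub>inverse_limit Q p\<^esub> s \<in> U}"
      then have s: "s \<in> ?L" "inv\<^bsub>inverse_limit Q p\<^esub> s \<in> U" by auto
      obtain i where
        i: "\<And>r. \<lbrakk>r \<in> ?L; r i = (inv\<^bsub>inverse_limit Q p\<^esub> s) i\<rbrakk> \<Longrightarrow> r \<in> U"
        using openin_inverse_limit_topologyD[OF U s(2)] by blast
      have "\<forall>t\<in>?L. t i = s i \<longrightarrow> inv\<^bsub>inverse_limit Q p\<^esub> t \<in> U"
      proof (intro ballI impI i)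
        show "inv\<^bsub>inverse_limit Q p\<^esub> t \<in> ?L" if "t \<in> ?L" for t
          using that by (rule L.inv_closed)
        show "(inv\<^bsub>inverse_limit Q p\<^esub> t) i = (inv\<^bsub>inverse_limit Q p\<^esub> s) i"
          if "t \<in> ?L" "t i = s i" for t
          using that by (simp add: inv_L[OF that(1)] inv_L[OF s(1)])
      qed
      then show "\<exists>i. \<forall>t\<in>?L. t i = s i \<longrightarrow> t \<in> {s \<in> topspace ?T. inv\<^bsub>inverse_limit Q p\<^esub> s \<in> U}"
        by auto
    qed auto
  qed
  ultimately show "topological_group (inverse_limit Q p) ?T"
    using group_L by (simp add: topological_group_def)
qed

section \<open>Isomorphisms of topological groups\<close>

text \<open>Phrased with images so that two topologies with parallel descriptions of their open sets
  can be compared by rewriting alone.\<close>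

lemma homeomorphic_map_iff_openin:
  assumes "bij_betw f (topspace S) (topspace T)"
    and "\<And>U. U \<subseteq> topspace S \<Longrightarrow> openin T (f ` U) \<longleftrightarrow> openin S U"
  shows "homeomorphic_map S T f"
proof (rule bijective_open_imp_homeomorphic_map)
  have inj: "inj_on f (topspace S)" and img: "f ` topspace S = topspace T"
    using assms(1) by (auto simp: bij_betw_def)
  show "f ` topspace S = topspace T" "inj_on f (topspace S)"
    by (fact img inj)+
  show "open_map S T f"
    using assms(2) openin_subset by (auto simp: open_map_def)
  show "continuous_map S T f"
    unfolding continuous_map_def
  proof (intro conjI allI impI)
    show "f \<in> topspace S \<rightarrow> topspace T"
      using img by auto
    fix U assume U: "openin T U"
    have "f ` {a \<in> topspace S. f a \<in> U} = U"
      using img openin_subset[OF U] by auto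
    then show "openin S {a \<in> topspace S. f a \<in> U}"
      using assms(2)[of "{a \<in> topspace S. f a \<in> U}"] U by auto
  qed
qed

text \<open>With \<open>g\<close> the inverse homeomorphism, the operations of \<open>G\<close> are
  those of \<open>H\<close> sandwiched between \<open>f\<close> and \<open>g\<close>. This spares a
  direct proof that composition and inversion are continuous in the uniform topology.\<close>

lemma topological_group_transport:
  assumes "group G" "topspace S = carrier G" "topological_group H T"
    and iso: "f \<in> iso G H" and homeo: "homeomorphic_map S T f"
  shows "topological_group G S"
proof -
  interpret G: group G by (rule assms(1))
  have grpH: "group H" and topT: "topspace T = carrier H"
    and multT: "continuous_map (prod_topology T T) T (\<lambda>(a, b). a \<otimes>\<^bsub>H\<^esub> b)"
    and invT: "continuous_map T T (\<lambda>a. inv\<^bsub>H\<^esub> a)"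
    using assms(3) by (auto simp: topological_group_def)
  interpret f: group_hom G H f
    using iso grpH assms(1) by (simp add: group_hom_def group_hom_axioms_def iso_def)
  obtain g where "homeomorphic_maps S T f g"
    using homeo homeomorphic_map_maps by blast
  then have f: "continuous_map S T f" and g: "continuous_map T S g"
    and gf: "\<And>a. a \<in> carrier G \<Longrightarrow> g (f a) = a"
    using assms(2) by (auto simp: homeomorphic_maps_def)
  have ff: "continuous_map (prod_topology S S) (prod_topology T T) (\<lambda>(a, b). (f a, f b))"
    using f by (simp add: continuous_map_prod_top)
  have c: "continuous_map (prod_topology S S) S
      (g \<circ> ((\<lambda>(a, b). a \<otimes>\<^bsub>H\<^esub> b) \<circ> (\<lambda>(a, b). (f a, f b))))"
    by (intro continuous_map_compose[OF continuous_map_compose[OF ff multT] g])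
  have "g (f a \<otimes>\<^bsub>H\<^esub> f b) = a \<otimes>\<^bsub>G\<^esub> b" if "a \<in> carrier G" "b \<in> carrier G" for a b
    using gf[OF G.m_closed[OF that]] that by simp
  then have mult: "continuous_map (prod_topology S S) S (\<lambda>(a, b). a \<otimes>\<^bsub>G\<^esub> b)"
    by (intro continuous_map_eq[OF c]) (auto simp: assms(2))
  have c': "continuous_map S S (g \<circ> ((\<lambda>a. inv\<^bsub>H\<^esub> a) \<circ> f))"
    by (intro continuous_map_compose[OF continuous_map_compose[OF f invT] g])
  have "g (inv\<^bsub>H\<^esub> f a) = inv\<^bsub>G\<^esub> a" if "a \<in> carrier G" for a
    using gf[OF G.inv_closed[OF that]] that by simp
  then have "continuous_map S S (\<lambda>a. inv\<^bsub>G\<^esub> a)"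
    by (intro continuous_map_eq[OF c']) (auto simp: assms(2))
  with mult show ?thesis
    using assms(1,2) by (simp add: topological_group_def)
qed

lemma topological_group_subgroup:
  assumes "topological_group G S" "subgroup A G"
  shows "topological_group (G\<lparr>carrier := A\<rparr>) (subtopology S A)"
proof -
  interpret G: group G
    using assms(1) by (simp add: topological_group_def)
  have A: "A \<subseteq> carrier G" "topspace S = carrier G"
    using assms by (auto simp: topological_group_def subgroup.subset)
  have "continuous_map (prod_topology (subtopology S A) (subtopology S A)) (subtopology S A)
      (\<lambda>(a, b). a \<otimes>\<^bsub>G\<^esub> b)"
    using assms
    by (auto simp: topological_group_def continuous_map_in_subtopology prod_topology_subtopology
        subgroup.m_closed subtopology_subtopology intro!: continuous_map_from_subtopology)
  moreover have "continuous_map (subtopology S A) (subtopology S A) (\<lambda>a. inv\<^bsub>G\<^esub> a)"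
    using assms
    by (auto simp: topological_group_def continuous_map_in_subtopology
        subgroup.m_inv_closed intro!: continuous_map_from_subtopology)
  then have "continuous_map (subtopology S A) (subtopology S A) (\<lambda>a. inv\<^bsub>G\<lparr>carrier := A\<rparr>\<^esub> a)"
    by (rule continuous_map_eq) (auto simp: G.m_inv_consistent[OF assms(2)])
  ultimately show ?thesis
    using A G.subgroup_imp_group[OF assms(2)] by (auto simp: topological_group_def)
qed

lemma topological_group_iso_subgroup:
  assumes "topological_group_iso G S H T f" "subgroup A G"
  shows "topological_group_iso (G\<lparr>carrier := A\<rparr>) (subtopology S A)
    (H\<lparr>carrier := f ` A\<rparr>) (subtopology T (f ` A)) f"
proof -
  have tg: "topological_group G S" "topological_group H T" and iso: "f \<in> iso G H"
    and homeo: "homeomorphic_map S T f"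
    using assms(1) by (auto simp: topological_group_iso_def)
  have AG: "A \<subseteq> carrier G"
    by (rule subgroup.subset[OF assms(2)])
  interpret f: group_hom G H f
    using tg iso by (simp add: group_hom_def group_hom_axioms_def topological_group_def iso_def)
  have "f \<in> iso (G\<lparr>carrier := A\<rparr>) (H\<lparr>carrier := f ` A\<rparr>)"
    using iso AG by (auto simp: iso_def hom_def bij_betw_def subset_iff intro: inj_on_subset)
  moreover have "homeomorphic_map (subtopology S A) (subtopology T (f ` A)) f"
    using AG f.hom_closed tg
    by (intro homeomorphic_map_subtopologies[OF homeo]) (auto simp: topological_group_def)
  ultimately show ?thesis
    using topological_group_subgroup[OF tg(1) assms(2)]
      topological_group_subgroup[OF tg(2) f.subgroup_img_is_subgroup[OF assms(2)]]
    by (simp add: topological_group_iso_def)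
qed

section \<open>Cosets and the uniform metric\<close>

text \<open>Distinct cosets are disjoint, so a nonempty set lies in at most one of them and the
  description operator is well defined. The empty set would lie in every coset.\<close>

lemma (in group) coset_bond_eqI:
  assumes N: "subgroup N G" and B: "B \<in> rcosets N" and A: "A \<subseteq> B" "A \<noteq> {}"
  shows "coset_bond (G Mod N) A = B"
  unfolding coset_bond_def
proof (rule the_equality)
  show "B \<in> carrier (G Mod N) \<and> A \<subseteq> B"
    using A B by (simp add: FactGroup_def)
next
  obtain a where a: "a \<in> A"
    using A by blast
  have coset: "C = N #> a" if "C \<in> rcosets N" "a \<in> C" for C
    using that N repr_independence by (auto simp: RCOSETS_def)
  show "C = B" if "C \<in> carrier (G Mod N) \<and> A \<subseteq> C" for C
    using that coset[of C] coset[OF B] a A by (auto simp: FactGroup_def)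
qed

lemma carrier_FactGroup [simp]: "carrier (G Mod N) = rcosets\<^bsub>G\<^esub> N"
  by (simp add: FactGroup_def)

text \<open>Trades the bonding maps for plain inclusion. The groups \<open>F i\<close> vary with
  \<open>i\<close> so that the same lemma serves the limit core, with \<open>F i\<close> constant,
  and the discriminant group, with \<open>F i\<close> the chain itself.\<close>

lemma carrier_inverse_limit_cosets:
  assumes "\<And>i. group (F i)" and sub: "\<And>i. subgroup (N i) (F i)"
    and ref: "\<And>i A. A \<in> rcosets\<^bsub>F (Suc i)\<^esub> N (Suc i) \<Longrightarrow> \<exists>B\<in>rcosets\<^bsub>F i\<^esub> N i. A \<subseteq> B"
  shows "carrier (inverse_limit (\<lambda>i. F i Mod N i) (\<lambda>i. coset_bond (F i Mod N i))) =
    {s. \<forall>i. s i \<in> rcosets\<^bsub>F i\<^esub> N i \<and> s (Suc i) \<subseteq> s i}"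
proof -
  have "coset_bond (F i Mod N i) A = B \<longleftrightarrow> A \<subseteq> B"
    if A: "A \<in> rcosets\<^bsub>F (Suc i)\<^esub> N (Suc i)" and B: "B \<in> rcosets\<^bsub>F i\<^esub> N i" for i A B
  proof -
    interpret F: group "F i" by fact
    have ne: "A \<noteq> {}"
      using subgroup.rcosets_non_empty[OF sub A] .
    obtain B' where B': "B' \<in> rcosets\<^bsub>F i\<^esub> N i" "A \<subseteq> B'"
      using ref A by blast
    show ?thesis
      using F.coset_bond_eqI[OF sub B' ne] F.coset_bond_eqI[OF sub B _ ne] B'(2) by blast
  qed
  then show ?thesis
    unfolding set_eq_iff mem_inverse_limit_iff mem_Collect_eq by (metis carrier_FactGroup)
qed

text \<open>On representatives the bonding map is the identity: it sends \<open>M #> a\<close> to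
  \<open>N #> a\<close>.\<close>

lemma (in group) coset_bond_hom:
  assumes N: "N \<lhd> G" and M: "M \<lhd> G" and "M \<subseteq> N"
  shows "coset_bond (G Mod N) \<in> hom (G Mod M) (G Mod N)"
proof -
  interpret N: normal N G by fact
  interpret M: normal M G by fact
  have bond: "coset_bond (G Mod N) (M #> a) = N #> a" if "a \<in> carrier G" for a
  proof (rule coset_bond_eqI[OF N.subgroup_axioms])
    show "N #> a \<in> rcosets N"
      using that by (auto simp: RCOSETS_def)
    show "M #> a \<subseteq> N #> a"
      using assms(3) by (auto simp: r_coset_def)
    show "M #> a \<noteq> {}"
      using rcos_self[OF that M.subgroup_axioms] by blast
  qed
  have carr: "rcosets K = (\<lambda>a. K #> a) ` carrier G" for K
    by (auto simp: RCOSETS_def)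
  show ?thesis
    by (rule homI) (auto simp: carr bond M.rcos_sum N.rcos_sum)
qed

lemma mem_carrier_Homeo:
  "f \<in> carrier (Homeo m) \<longleftrightarrow>
     f \<in> Bij (mspace m) \<and> homeomorphic_map (mtopology_of m) (mtopology_of m) f"
  by (simp add: Homeo_def)

text \<open>The bound \<open>0 \<le> e\<close> also covers the default value 0 of
  \<open>uniform_dist\<close>, hence arbitrary \<open>f\<close> and \<open>g\<close>.\<close>

lemma uniform_dist_le:
  assumes "mspace m \<noteq> {}" "0 \<le> e" "\<And>u. u \<in> mspace m \<Longrightarrow> mdist m (f u) (g u) \<le> e"
  shows "uniform_dist m f g \<le> e"
  using assms by (auto simp: uniform_dist_def intro: cSUP_least)

lemma Homeo_in_mspace:
  "\<lbrakk>f \<in> carrier (Homeo m); u \<in> mspace m\<rbrakk> \<Longrightarrow> f u \<in> mspace m"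
  by (auto simp: mem_carrier_Homeo dest: Bij_imp_funcset)

text \<open>A real supremum is informative only for a set bounded above. This bound makes the
  suprema in \<open>mdiameter\<close> and \<open>uniform_dist\<close> genuine upper bounds.\<close>

lemma compact_space_mdist_bounded:
  assumes "compact_space (mtopology_of m)"
  shows "\<exists>b. \<forall>u\<in>mspace m. \<forall>v\<in>mspace m. mdist m u v \<le> b"
proof -
  interpret M: Metric_space "mspace m" "mdist m" by simp
  have "M.mbounded (mspace m)"
    using assms by (intro M.compactin_imp_mbounded) (simp add: compact_space_def mtopology_of_def)
  then show ?thesis
    unfolding M.mbounded_alt by blast
qed

lemma mdist_le_mdiameter:
  assumes "compact_space (mtopology_of m)" "S \<subseteq> mspace m" "u \<in> S" "v \<in> S"
  shows "mdist m u v \<le> mdiameter m S"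
proof -
  obtain b where b: "\<And>u v. \<lbrakk>u \<in> mspace m; v \<in> mspace m\<rbrakk> \<Longrightarrow> mdist m u v \<le> b"
    using compact_space_mdist_bounded[OF assms(1)] by blast
  have "bdd_above ((\<lambda>(u, v). mdist m u v) ` (S \<times> S))"
    using b assms(2) by (intro bdd_aboveI2[of _ _ b]) auto
  then show ?thesis
    using cSUP_upper[of "(u, v)" "S \<times> S" "\<lambda>(u, v). mdist m u v"] assms(3,4)
    by (auto simp: mdiameter_def)
qed

lemma mdist_le_uniform_dist:
  assumes "compact_space (mtopology_of m)" "f \<in> carrier (Homeo m)" "g \<in> carrier (Homeo m)"
    and u: "u \<in> mspace m"
  shows "mdist m (f u) (g u) \<le> uniform_dist m f g"
proof -
  obtain b where "\<And>v w. \<lbrakk>v \<in> mspace m; w \<in> mspace m\<rbrakk> \<Longrightarrow> mdist m v w \<le> b"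
    using compact_space_mdist_bounded[OF assms(1)] by blast
  then have "bdd_above ((\<lambda>u. mdist m (f u) (g u)) ` mspace m)"
    using assms(2,3) by (intro bdd_aboveI2[of _ _ b]) (simp add: Homeo_in_mspace)
  then show ?thesis
    using assms(2,3) cSUP_upper[OF u, of "\<lambda>u. mdist m (f u) (g u)"] by (simp add: uniform_dist_def)
qed

lemma Metric_space_uniform_dist:
  assumes "compact_space (mtopology_of m)" and ne: "mspace m \<noteq> {}"
  shows "Metric_space (carrier (Homeo m)) (uniform_dist m)"
proof
  note le = mdist_le_uniform_dist[OF assms(1)]
  fix f g
  obtain u where u: "u \<in> mspace m"
    using ne by blast
  show "0 \<le> uniform_dist m f g"
  proof (cases "f \<in> carrier (Homeo m) \<and> g \<in> carrier (Homeo m)")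
    case True
    then show ?thesis
      using le[of f g u] u by (meson mdist_nonneg order_trans)
  qed (auto simp: uniform_dist_def)
  show "uniform_dist m f g = uniform_dist m g f"
    by (simp add: uniform_dist_def mdist_commute conj_commute)
  assume f: "f \<in> carrier (Homeo m)" and g: "g \<in> carrier (Homeo m)"
  show "uniform_dist m f g = 0 \<longleftrightarrow> f = g"
  proof
    assume 0: "uniform_dist m f g = 0"
    have "f u = g u" if "u \<in> mspace m" for u
      using le[OF f g that] f g that 0 mdist_nonneg[of m "f u" "g u"]
      by (simp add: Homeo_in_mspace)
    \<comment> \<open>The distance sees values on \<open>mspace m\<close> only; extensionality fixes
      the rest.\<close>
    then show "f = g"
      using f g by (auto simp: mem_carrier_Homeo dest!: Bij_imp_extensional intro: extensionalityI)
  next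
    assume "f = g"
    then show "uniform_dist m f g = 0"
      using uniform_dist_le[OF ne, of 0 f f] \<open>0 \<le> uniform_dist m f g\<close> Homeo_in_mspace[OF f]
      by (simp add: order.antisym mdist_zero[THEN iffD2])
  qed
  fix h assume h: "h \<in> carrier (Homeo m)"
  show "uniform_dist m f h \<le> uniform_dist m f g + uniform_dist m g h"
    unfolding uniform_dist_def[of m f h]
  proof (simp add: f h, rule cSUP_least[OF ne])
    fix u assume u: "u \<in> mspace m"
    have "mdist m (f u) (h u) \<le> mdist m (f u) (g u) + mdist m (g u) (h u)"
      using f g h u by (simp add: mdist_triangle Homeo_in_mspace)
    then show "mdist m (f u) (h u) \<le> uniform_dist m f g + uniform_dist m g h"
      using le[OF f g u] le[OF g h u] by linarith
  qed
qed

section \<open>Invariant equivalence relations\<close>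

text \<open>Isolates what the argument takes from the clopen sets \<open>V i\<close>.
  \<open>R_open\<close> makes the classes uniformly open, \<open>R_small\<close> lets them shrink,
  \<open>R_orbit\<close> says that every class meets the orbit of \<open>x\<close>, and
  \<open>Gs_eq\<close> makes \<open>Gs i\<close> the stabiliser of the class of
  \<open>x\<close>.\<close>

locale invariant_cells = group_action G "mspace m" \<Phi>
  for m :: "'a metric" and G :: "('g, 'r) monoid_scheme" (structure) and \<Phi> :: "'g \<Rightarrow> 'a \<Rightarrow> 'a" +
  fixes R :: "nat \<Rightarrow> 'a \<Rightarrow> 'a \<Rightarrow> bool" and x :: 'a and Gs :: "nat \<Rightarrow> 'g set"
  assumes compact: "compact_space (mtopology_of m)"
    and base: "x \<in> mspace m"
    and R_mspace: "R i u v \<Longrightarrow> u \<in> mspace m"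
    and R_refl: "u \<in> mspace m \<Longrightarrow> R i u u"
    and R_sym: "R i u v \<Longrightarrow> R i v u"
    and R_trans: "R i u v \<Longrightarrow> R i v w \<Longrightarrow> R i u w"
    and R_Suc: "R (Suc i) u v \<Longrightarrow> R i u v"
    and R_act: "\<lbrakk>g \<in> carrier G; R i u v\<rbrakk> \<Longrightarrow> R i (\<Phi> g u) (\<Phi> g v)"
    and R_open: "\<exists>\<delta>>0. \<forall>u\<in>mspace m. \<forall>v\<in>mspace m. mdist m u v < \<delta> \<longrightarrow> R i u v"
    and R_small: "e > 0 \<Longrightarrow> \<exists>i. \<forall>u v. R i u v \<longrightarrow> mdist m u v < e"
    and R_orbit: "u \<in> mspace m \<Longrightarrow> \<exists>h\<in>carrier G. R i u (\<Phi> h x)"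
    and Gs_eq: "Gs i = {g \<in> carrier G. R i (\<Phi> g x) x}"
begin

sublocale G: group G
  using group_hom by (simp add: group_hom_def)

lemma act_closed: "\<lbrakk>g \<in> carrier G; u \<in> mspace m\<rbrakk> \<Longrightarrow> \<Phi> g u \<in> mspace m"
  using element_image by blast

lemma act_inv [simp]:
  assumes "g \<in> carrier G" "u \<in> mspace m"
  shows "\<Phi> (inv g) (\<Phi> g u) = u" and "\<Phi> g (\<Phi> (inv g) u) = u"
proof -
  have *: "\<Phi> (inv g) (\<Phi> g u) = u" if "g \<in> carrier G" for g
    using orbit_sym_aux[OF that assms(2)] by simp
  from *[of "inv g"] *[of g] assms(1) show "\<Phi> (inv g) (\<Phi> g u) = u" "\<Phi> g (\<Phi> (inv g) u) = u"
    by simp_all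
qed

lemma act_one [simp]: "u \<in> mspace m \<Longrightarrow> \<Phi> \<one> u = u"
  using id_eq_one by (metis restrict_apply')

lemma R_mspace2: "R i u v \<Longrightarrow> v \<in> mspace m"
  using R_mspace R_sym by blast

lemma R_eucl: "\<lbrakk>R i u w; R i v w\<rbrakk> \<Longrightarrow> R i u v"
  using R_trans R_sym by metis

lemma R_separates:
  assumes "\<And>i. R i u v"
  shows "u = v"
proof (rule ccontr)
  assume "u \<noteq> v"
  then have "mdist m u v > 0"
    using assms R_mspace R_mspace2 mdist_zero mdist_nonneg by (metis order_le_less)
  then show False
    using R_small[of "mdist m u v"] assms by blast
qed

text \<open>The complement of a class is a union of classes, and each class contains a ball of the
  same radius around each of its points. Closedness feeds the nested intersection argument.\<close>

lemma closedin_R: "closedin (mtopology_of m) {v. R i v u}"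
proof -
  interpret M: Metric_space "mspace m" "mdist m" by simp
  obtain \<delta> where \<delta>: "\<delta> > 0" "\<And>u v. \<lbrakk>u \<in> mspace m; v \<in> mspace m; mdist m u v < \<delta>\<rbrakk> \<Longrightarrow> R i u v"
    using R_open[of i] by blast
  have "openin M.mtopology (mspace m - {v. R i v u})"
    unfolding M.openin_mtopology
  proof (intro conjI allI impI)
    fix v assume v: "v \<in> mspace m - {v. R i v u}"
    have "\<not> R i w u" if "w \<in> M.mball v \<delta>" for w
      using that v \<delta>(2)[of v w] R_trans[of i v w u] by auto
    then show "\<exists>r>0. M.mball v r \<subseteq> mspace m - {v. R i v u}"
      using \<delta>(1) by (intro exI[of _ \<delta>]) auto
  qed auto
  then show ?thesis
    using R_mspace[of i _ u] by (auto simp: closedin_def mtopology_of_def)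
qed

section \<open>Maps approximated by group elements, and the closure group\<close>

definition coset_at :: "('a \<Rightarrow> 'a) \<Rightarrow> nat \<Rightarrow> 'g set" where
  "coset_at f i = {g \<in> carrier G. \<forall>u\<in>mspace m. R i (f u) (\<Phi> g u)}"

text \<open>A metric-free candidate for the closure: at every level some group element approximates
  \<open>f\<close>. Asking for \<open>Bij\<close> only is deliberate, since continuity will follow;
  \<open>Bij\<close> also provides extensionality.\<close>

definition limit_maps :: "('a \<Rightarrow> 'a) set" where
  "limit_maps = {f \<in> Bij (mspace m). \<forall>i. coset_at f i \<noteq> {}}"

lemma coset_atD:
  assumes "g \<in> coset_at f i"
  shows "g \<in> carrier G" "u \<in> mspace m \<Longrightarrow> R i (f u) (\<Phi> g u)"
  using assms by (auto simp: coset_at_def)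

lemma limit_maps_closed: "\<lbrakk>f \<in> limit_maps; u \<in> mspace m\<rbrakk> \<Longrightarrow> f u \<in> mspace m"
  by (auto simp: limit_maps_def dest: Bij_imp_funcset)

text \<open>At level \<open>i\<close> the map \<open>f\<close> cannot be told from some
  \<open>g\<close> in \<open>G\<close>, and \<open>g\<close> respects \<open>R i\<close>.\<close>

lemma limit_maps_R:
  assumes "f \<in> limit_maps" "R i u v"
  shows "R i (f u) (f v)"
proof -
  obtain g where g: "g \<in> coset_at f i"
    using assms(1) by (auto simp: limit_maps_def)
  have "R i (f u) (\<Phi> g u)" "R i (f v) (\<Phi> g v)"
    using coset_atD(2)[OF g] R_mspace[OF assms(2)] R_mspace2[OF assms(2)] by auto
  then show ?thesis
    using R_act[OF coset_atD(1)[OF g] assms(2)] R_trans[of i "f u"] R_sym[of i "f v"] by blast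
qed

lemma act_limit_maps: "g \<in> carrier G \<Longrightarrow> \<Phi> g \<in> limit_maps"
proof -
  assume g: "g \<in> carrier G"
  have "g \<in> coset_at (\<Phi> g) i" for i
    using g by (simp add: coset_at_def R_refl act_closed)
  then show ?thesis
    using bij_prop0[OF g] by (auto simp: limit_maps_def)
qed

text \<open>Preserving every \<open>R i\<close> gives continuity: near points share a class, and
  their images share a small one. A continuous bijection of a compact Hausdorff space is a
  homeomorphism.\<close>

lemma limit_maps_Homeo: "f \<in> limit_maps \<Longrightarrow> f \<in> carrier (Homeo m)"
proof -
  assume f: "f \<in> limit_maps"
  interpret M: Metric_space "mspace m" "mdist m" by simp
  have bij: "f ` mspace m = mspace m" "inj_on f (mspace m)" "f \<in> Bij (mspace m)"
    using f by (auto simp: limit_maps_def Bij_def bij_betw_def)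
  have "continuous_map M.mtopology M.mtopology f"
    unfolding M.metric_continuous_map[OF M.Metric_space_axioms]
  proof (intro conjI ballI allI impI)
    show "f ` mspace m \<subseteq> mspace m"
      using bij by simp
    fix u and e :: real assume u: "u \<in> mspace m" and "e > 0"
    then obtain i where i: "\<And>u v. R i u v \<Longrightarrow> mdist m u v < e"
      using R_small by blast
    obtain \<delta> where "\<delta> > 0" "\<And>u v. \<lbrakk>u \<in> mspace m; v \<in> mspace m; mdist m u v < \<delta>\<rbrakk> \<Longrightarrow> R i u v"
      using R_open[of i] by blast
    then show "\<exists>\<delta>>0. \<forall>v. v \<in> mspace m \<and> mdist m u v < \<delta> \<longrightarrow> mdist m (f u) (f v) < e"
      using u i limit_maps_R[OF f] by blast
  qed
  then have "homeomorphic_map (mtopology_of m) (mtopology_of m) f"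
    using compact bij
    by (intro continuous_imp_homeomorphic_map) (auto simp: mtopology_of_def M.Hausdorff_space_mtopology)
  then show ?thesis
    using bij by (simp add: mem_carrier_Homeo)
qed

text \<open>With \<open>R_imp_uniform_dist\<close> this shows that uniform closeness and pointwise
  agreement up to \<open>R i\<close> are interchangeable; both the closure and the topology are
  computed from this pair.\<close>

lemma uniform_dist_imp_R:
  "\<exists>\<delta>>0. \<forall>f\<in>carrier (Homeo m). \<forall>k\<in>carrier (Homeo m). uniform_dist m f k < \<delta> \<longrightarrow>
     (\<forall>u\<in>mspace m. R i (f u) (k u))"
proof -
  obtain \<delta> where "\<delta> > 0"
    and \<delta>: "\<And>u v. \<lbrakk>u \<in> mspace m; v \<in> mspace m; mdist m u v < \<delta>\<rbrakk> \<Longrightarrow> R i u v"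
    using R_open[of i] by blast
  have "R i (f u) (k u)" if "f \<in> carrier (Homeo m)" "k \<in> carrier (Homeo m)"
    "uniform_dist m f k < \<delta>" "u \<in> mspace m" for f k u
    using that \<delta>[of "f u" "k u"] mdist_le_uniform_dist[OF compact, of f k u]
    by (simp add: Homeo_in_mspace)
  then show ?thesis
    using \<open>\<delta> > 0\<close> by blast
qed

lemma R_imp_uniform_dist:
  assumes "e > 0"
  shows "\<exists>i. \<forall>f k. (\<forall>u\<in>mspace m. R i (f u) (k u)) \<longrightarrow> uniform_dist m f k < e"
proof -
  \<comment> \<open>Strict bounds become weak under a supremum; halving \<open>e\<close> restores
    strictness.\<close>
  obtain i where i: "\<And>u v. R i u v \<Longrightarrow> mdist m u v < e / 2"
    using R_small[of "e / 2"] assms by auto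
  have "uniform_dist m f k \<le> e / 2" if "\<forall>u\<in>mspace m. R i (f u) (k u)" for f k
    using that i base assms by (intro uniform_dist_le) (auto intro: less_imp_le)
  then show ?thesis
    using assms by (intro exI[of _ i]) force
qed

lemma closure_group_eq: "closure_group m G \<Phi> = Homeo m\<lparr>carrier := limit_maps\<rparr>"
proof -
  interpret U: Metric_space "carrier (Homeo m)" "uniform_dist m"
    using Metric_space_uniform_dist compact base by blast
  have "U.mtopology closure_of (\<Phi> ` carrier G) = limit_maps"
  proof (intro subset_antisym subsetI)
    fix f assume "f \<in> U.mtopology closure_of (\<Phi> ` carrier G)"
    then have f: "f \<in> carrier (Homeo m)"
      and near: "\<And>r. r > 0 \<Longrightarrow> \<exists>g\<in>carrier G. uniform_dist m f (\<Phi> g) < r"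
      by (auto simp: U.metric_closure_of)
    have "coset_at f i \<noteq> {}" for i
    proof -
      obtain \<delta> where "\<delta> > 0" and \<delta>: "\<forall>f\<in>carrier (Homeo m). \<forall>k\<in>carrier (Homeo m).
          uniform_dist m f k < \<delta> \<longrightarrow> (\<forall>u\<in>mspace m. R i (f u) (k u))"
        using uniform_dist_imp_R by blast
      obtain g where g: "g \<in> carrier G" "uniform_dist m f (\<Phi> g) < \<delta>"
        using near[OF \<open>\<delta> > 0\<close>] by blast
      then have "g \<in> coset_at f i"
        using \<delta> f limit_maps_Homeo[OF act_limit_maps[OF g(1)]] by (auto simp: coset_at_def)
      then show ?thesis by blast
    qed
    then show "f \<in> limit_maps"
      using f by (simp add: limit_maps_def mem_carrier_Homeo)
  next
    fix f assume f: "f \<in> limit_maps"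
    have "\<exists>g\<in>carrier G. uniform_dist m f (\<Phi> g) < r" if r: "r > 0" for r
    proof -
      obtain i where i: "\<forall>f k. (\<forall>u\<in>mspace m. R i (f u) (k u)) \<longrightarrow> uniform_dist m f k < r"
        using R_imp_uniform_dist[OF r] by blast
      obtain g where "g \<in> coset_at f i"
        using f by (auto simp: limit_maps_def)
      then show ?thesis
        using i by (auto simp: coset_at_def)
    qed
    then show "f \<in> U.mtopology closure_of (\<Phi> ` carrier G)"
      using limit_maps_Homeo f act_limit_maps by (force simp: U.metric_closure_of)
  qed
  then show ?thesis
    by (simp add: closure_group_def uniform_topology_def)
qed

lemma closure_group_mult:
  assumes "f \<in> limit_maps" "k \<in> limit_maps"
  shows "f \<otimes>\<^bsub>closure_group m G \<Phi>\<^esub> k = compose (mspace m) f k"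
  using assms by (simp add: closure_group_eq Homeo_def BijGroup_def limit_maps_def)

text \<open>At the point \<open>k u\<close> replace \<open>f\<close> by \<open>g\<close>; then
  replace \<open>k u\<close> by \<open>\<Phi> h u\<close> inside \<open>g\<close>, which respects
  \<open>R i\<close>.\<close>

lemma coset_at_compose:
  assumes f: "f \<in> limit_maps" and k: "k \<in> limit_maps"
    and g: "g \<in> coset_at f i" and h: "h \<in> coset_at k i"
  shows "g \<otimes> h \<in> coset_at (compose (mspace m) f k) i"
proof -
  note gD = coset_atD[OF g] and hD = coset_atD[OF h]
  have "R i (compose (mspace m) f k u) (\<Phi> (g \<otimes> h) u)" if u: "u \<in> mspace m" for u
  proof -
    have "R i (f (k u)) (\<Phi> g (k u))"
      using gD(2) limit_maps_closed[OF k u] .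
    moreover have "R i (\<Phi> g (k u)) (\<Phi> g (\<Phi> h u))"
      using R_act[OF gD(1)] hD(2)[OF u] .
    ultimately have "R i (f (k u)) (\<Phi> g (\<Phi> h u))"
      by (rule R_trans)
    then show ?thesis
      using u by (simp add: compose_eq composition_rule[OF u gD(1) hD(1)])
  qed
  then show ?thesis
    using gD(1) hD(1) by (simp add: coset_at_def)
qed

text \<open>For \<open>u = f w\<close>, apply \<open>inv g\<close> to the relation between
  \<open>f w\<close> and \<open>\<Phi> g w\<close>. The restricted \<open>inv_into\<close> is the
  form that inverses take in \<open>BijGroup\<close>.\<close>

lemma coset_at_inv:
  assumes f: "f \<in> limit_maps" and g: "g \<in> coset_at f i"
  shows "inv g \<in> coset_at (restrict (inv_into (mspace m) f) (mspace m)) i"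
proof -
  note gD = coset_atD[OF g]
  have "R i (inv_into (mspace m) f u) (\<Phi> (inv g) u)" if u: "u \<in> mspace m" for u
  proof -
    have img: "u \<in> f ` mspace m"
      using f u by (auto simp: limit_maps_def Bij_def bij_betw_def)
    define w where "w = inv_into (mspace m) f u"
    have w: "w \<in> mspace m" "f w = u"
      using img by (auto simp: w_def inv_into_into f_inv_into_f)
    have "R i u (\<Phi> g w)"
      using gD(2)[OF w(1)] w(2) by simp
    from R_act[OF G.inv_closed[OF gD(1)] this] have "R i (\<Phi> (inv g) u) w"
      using gD(1) w(1) by simp
    then show ?thesis
      unfolding w_def by (rule R_sym)
  qed
  then show ?thesis
    using gD(1) by (simp add: coset_at_def)
qed

lemma group_closure_group: "group (closure_group m G \<Phi>)"
proof -
  interpret B: group "BijGroup (mspace m)"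
    by (rule group_BijGroup)
  have "subgroup limit_maps (BijGroup (mspace m))"
  proof (rule B.subgroupI)
    show "limit_maps \<subseteq> carrier (BijGroup (mspace m))"
      by (auto simp: limit_maps_def BijGroup_def)
    show "limit_maps \<noteq> {}"
      using act_limit_maps[OF G.one_closed] by blast
  next
    fix f assume f: "f \<in> limit_maps"
    then have "f \<in> Bij (mspace m)" "\<And>i. coset_at f i \<noteq> {}"
      by (auto simp: limit_maps_def)
    then show "inv\<^bsub>BijGroup (mspace m)\<^esub> f \<in> limit_maps"
      using coset_at_inv[OF f]
      by (simp add: limit_maps_def inv_BijGroup restrict_inv_into_Bij) blast
  next
    fix f k assume fk: "f \<in> limit_maps" "k \<in> limit_maps"
    then have bij: "f \<in> Bij (mspace m)" "k \<in> Bij (mspace m)"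
      and "\<And>i. coset_at f i \<noteq> {}" "\<And>i. coset_at k i \<noteq> {}"
      by (auto simp: limit_maps_def)
    then have "coset_at (compose (mspace m) f k) i \<noteq> {}" for i
      using coset_at_compose[OF fk] by blast
    with bij show "f \<otimes>\<^bsub>BijGroup (mspace m)\<^esub> k \<in> limit_maps"
      by (simp add: limit_maps_def BijGroup_def compose_Bij)
  qed
  then have "group (BijGroup (mspace m)\<lparr>carrier := limit_maps\<rparr>)"
    by (rule B.subgroup_imp_group)
  then show ?thesis
    by (simp add: closure_group_eq Homeo_def)
qed

section \<open>Cores of the chain and their cosets\<close>

abbreviation core :: "nat \<Rightarrow> 'g set" where
  "core \<equiv> chain_core G Gs"

text \<open>The conjugate of \<open>Gs i\<close> by \<open>h\<close> stabilises the class of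
  \<open>\<Phi> h x\<close>, and by \<open>R_orbit\<close> these are all the classes. So the core is
  the kernel of the action on the classes of \<open>R i\<close>.\<close>

lemma core_eq: "core i = {g \<in> carrier G. \<forall>u\<in>mspace m. R i (\<Phi> g u) u}"
proof -
  have conj: "g \<in> (h <# Gs i) #> inv h \<longleftrightarrow> g \<in> carrier G \<and> R i (\<Phi> g (\<Phi> h x)) (\<Phi> h x)"
    if h: "h \<in> carrier G" for g h
  proof -
    have "g \<in> (h <# Gs i) #> inv h \<longleftrightarrow> g \<in> carrier G \<and> inv h \<otimes> g \<otimes> h \<in> Gs i"
    proof
      assume "g \<in> (h <# Gs i) #> inv h"
      then obtain k where k: "k \<in> Gs i" "g = h \<otimes> k \<otimes> inv h"
        by (auto simp: l_coset_def r_coset_def)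
      then have "k \<in> carrier G"
        by (simp add: Gs_eq)
      then have "inv h \<otimes> g \<otimes> h = k"
        using k h by (simp add: G.m_assoc) (simp add: G.inv_solve_left flip: G.m_assoc)
      then show "g \<in> carrier G \<and> inv h \<otimes> g \<otimes> h \<in> Gs i"
        using k h \<open>k \<in> carrier G\<close> by simp
    next
      assume *: "g \<in> carrier G \<and> inv h \<otimes> g \<otimes> h \<in> Gs i"
      then have "h \<otimes> (inv h \<otimes> g \<otimes> h) \<otimes> inv h = g"
        using h by (simp add: G.m_assoc) (simp flip: G.m_assoc)
      then show "g \<in> (h <# Gs i) #> inv h"
        using * by (force simp: l_coset_def r_coset_def)
    qed
    also have "\<dots> \<longleftrightarrow> g \<in> carrier G \<and> R i (\<Phi> g (\<Phi> h x)) (\<Phi> h x)"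
    proof (rule conj_cong[OF refl])
      assume g: "g \<in> carrier G"
      have "\<Phi> (inv h \<otimes> g \<otimes> h) x = \<Phi> (inv h) (\<Phi> g (\<Phi> h x))"
        using g h base by (simp add: composition_rule act_closed)
      then show "inv h \<otimes> g \<otimes> h \<in> Gs i \<longleftrightarrow> R i (\<Phi> g (\<Phi> h x)) (\<Phi> h x)"
        using g h base R_act[OF h, of i "\<Phi> (inv h) (\<Phi> g (\<Phi> h x))" x]
          R_act[OF G.inv_closed[OF h], of i "\<Phi> g (\<Phi> h x)" "\<Phi> h x"]
        by (auto simp: Gs_eq act_closed)
    qed
    finally show ?thesis .
  qed
  have "R i (\<Phi> g u) u" if g: "g \<in> carrier G" and u: "u \<in> mspace m"
    and stab: "\<forall>h\<in>carrier G. R i (\<Phi> g (\<Phi> h x)) (\<Phi> h x)" for g u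
  proof -
    obtain h where h: "h \<in> carrier G" "R i u (\<Phi> h x)"
      using R_orbit[OF u] by blast
    then show ?thesis
      using stab R_act[OF g h(2)] R_trans[of i "\<Phi> g u"] R_sym[OF h(2)] by blast
  qed
  moreover have "g \<in> core i \<longleftrightarrow> g \<in> carrier G \<and> (\<forall>h\<in>carrier G. R i (\<Phi> g (\<Phi> h x)) (\<Phi> h x))" for g
    using conj G.one_closed by (auto simp: chain_core_def)
  ultimately show ?thesis
    using base by (auto simp: act_closed)
qed

lemma Gs_subgroup: "subgroup (Gs i) G"
proof (rule G.subgroupI)
  show "Gs i \<subseteq> carrier G"
    by (auto simp: Gs_eq)
  show "Gs i \<noteq> {}"
    using G.one_closed base R_refl by (force simp: Gs_eq)
  show "inv g \<in> Gs i" if "g \<in> Gs i" for g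
    using that R_act[OF G.inv_closed, of g i "\<Phi> g x" x] base R_sym[of i x] by (auto simp: Gs_eq)
  show "g \<otimes> h \<in> Gs i" if "g \<in> Gs i" "h \<in> Gs i" for g h
    using that R_act[of g i "\<Phi> h x" x] base R_trans[of i "\<Phi> g (\<Phi> h x)" "\<Phi> g x" x] by (auto simp: Gs_eq composition_rule)
qed

lemma core_normal: "core i \<lhd> G"
proof -
  have "subgroup (core i) G"
  proof (rule G.subgroupI)
    show "core i \<subseteq> carrier G"
      by (auto simp: core_eq)
    show "core i \<noteq> {}"
      using R_refl by (auto simp: core_eq intro!: exI[of _ \<one>])
    show "inv g \<in> core i" if "g \<in> core i" for g
    proof -
      have "R i (\<Phi> (inv g) u) u" if u: "u \<in> mspace m" for u
        using \<open>g \<in> core i\<close> u R_act[OF G.inv_closed, of g i "\<Phi> g u" u] R_sym[of i u]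
        by (auto simp: core_eq)
      then show ?thesis
        using that by (auto simp: core_eq)
    qed
    show "g \<otimes> h \<in> core i" if gh: "g \<in> core i" "h \<in> core i" for g h
    proof -
      have "R i (\<Phi> (g \<otimes> h) u) u" if u: "u \<in> mspace m" for u
        using gh u R_act[of g i "\<Phi> h u" u] R_trans[of i "\<Phi> g (\<Phi> h u)" "\<Phi> g u" u] by (auto simp: core_eq composition_rule)
      then show ?thesis
        using gh by (auto simp: core_eq)
    qed
  qed
  moreover have "g \<otimes> h \<otimes> inv g \<in> core i" if g: "g \<in> carrier G" and h: "h \<in> core i" for g h
  proof -
    have "R i (\<Phi> (g \<otimes> h \<otimes> inv g) u) u" if u: "u \<in> mspace m" for u
    proof -
      \<comment> \<open>\<open>h\<close> fixes every class, in particular that of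
        \<open>\<Phi> (inv g) u\<close>; applying \<open>g\<close> moves this back to
        \<open>u\<close>.\<close>
      have "R i (\<Phi> h (\<Phi> (inv g) u)) (\<Phi> (inv g) u)"
        using g h u by (auto simp: core_eq act_closed)
      from R_act[OF g this] show ?thesis
        using g h u by (auto simp: core_eq composition_rule act_closed)
    qed
    then show ?thesis
      using g h by (auto simp: core_eq)
  qed
  ultimately show ?thesis
    by (simp add: G.normal_inv_iff)
qed

lemma core_subset_Gs: "core i \<subseteq> Gs i"
  using base by (auto simp: core_eq Gs_eq)

lemma core_Suc: "core (Suc i) \<subseteq> core i"
  using R_Suc by (auto simp: core_eq)

lemma Gs_Suc: "Gs (Suc i) \<subseteq> Gs i"
  using R_Suc by (auto simp: Gs_eq)

text \<open>Two elements approximate the same \<open>f\<close> at level \<open>i\<close> iff they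
  act alike on the classes of \<open>R i\<close>, that is, iff they differ by an element of the
  kernel \<open>core i\<close>.\<close>

lemma coset_at_eq:
  assumes g: "g \<in> coset_at f i"
  shows "coset_at f i = core i #> g"
proof -
  note gD = coset_atD[OF g]
  interpret N: normal "core i" G by (rule core_normal)
  have "h \<in> coset_at f i \<longleftrightarrow> h \<in> core i #> g" if h: "h \<in> carrier G" for h
  proof -
    have "R i (f u) (\<Phi> h u) \<longleftrightarrow> R i (\<Phi> h u) (\<Phi> g u)" if "u \<in> mspace m" for u
      using R_eucl[OF R_sym R_sym, of i "f u" "\<Phi> h u" "\<Phi> g u"] R_eucl[of i "f u" "\<Phi> g u" "\<Phi> h u"]
        gD(2)[OF that] by blast
    then have "h \<in> coset_at f i \<longleftrightarrow> (\<forall>u\<in>mspace m. R i (\<Phi> h u) (\<Phi> g u))"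
      using h by (simp add: coset_at_def)
    \<comment> \<open>Substitute \<open>\<Phi> (inv g) u\<close> for \<open>u\<close> in one
      direction and \<open>\<Phi> g u\<close> in the other.\<close>
    also have "\<dots> \<longleftrightarrow> (\<forall>u\<in>mspace m. R i (\<Phi> (h \<otimes> inv g) u) u)"
    proof (intro iffI ballI)
      fix u assume u: "u \<in> mspace m" and *: "\<forall>u\<in>mspace m. R i (\<Phi> h u) (\<Phi> g u)"
      show "R i (\<Phi> (h \<otimes> inv g) u) u"
        using *[rule_format, of "\<Phi> (inv g) u"] u h gD(1) by (simp add: act_closed composition_rule)
    next
      fix u assume u: "u \<in> mspace m" and *: "\<forall>u\<in>mspace m. R i (\<Phi> (h \<otimes> inv g) u) u"
      show "R i (\<Phi> h u) (\<Phi> g u)"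
        using *[rule_format, of "\<Phi> g u"] u h gD(1) by (simp add: act_closed composition_rule)
    qed
    also have "\<dots> \<longleftrightarrow> h \<otimes> inv g \<in> core i"
      using G.m_closed[OF h G.inv_closed[OF gD(1)]] unfolding core_eq by blast
    also have "\<dots> \<longleftrightarrow> h \<in> core i #> g"
      using N.rcos_module[OF G.is_group gD(1) h] by blast
    finally show ?thesis .
  qed
  moreover have "core i #> g \<subseteq> carrier G"
    using gD(1) by (simp add: G.r_coset_subset_G N.subset)
  ultimately show ?thesis
    using coset_atD(1) by blast
qed

text \<open>This is the naturality clause: \<open>g\<close> approximates \<open>\<Phi> g\<close> at
  every level, and normality turns the right coset of \<open>coset_at_eq\<close> into the left coset
  of the theorem.\<close>

lemma coset_at_act:
  assumes "g \<in> carrier G"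
  shows "coset_at (\<Phi> g) i = g <# core i"
proof -
  have "g \<in> coset_at (\<Phi> g) i"
    using assms by (auto simp: coset_at_def intro: R_refl act_closed)
  from coset_at_eq[OF this] show ?thesis
    using normal.coset_eq[OF core_normal, of i] assms by blast
qed

lemma coset_at_nonempty: "f \<in> limit_maps \<Longrightarrow> \<exists>g. g \<in> coset_at f i"
  by (auto simp: limit_maps_def)

text \<open>The bridge between the sides: agreement at coordinate \<open>i\<close> in the limit core
  means pointwise agreement up to \<open>R i\<close> of the maps.\<close>

lemma coset_at_eq_iff:
  assumes f: "f \<in> limit_maps" and k: "k \<in> limit_maps"
  shows "coset_at f i = coset_at k i \<longleftrightarrow> (\<forall>u\<in>mspace m. R i (f u) (k u))"
proof
  assume eq: "coset_at f i = coset_at k i"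
  obtain g where g: "g \<in> coset_at f i"
    using coset_at_nonempty[OF f] by blast
  then have g': "g \<in> coset_at k i"
    by (simp add: eq)
  show "\<forall>u\<in>mspace m. R i (f u) (k u)"
    using R_eucl[OF coset_atD(2)[OF g] coset_atD(2)[OF g']] by blast
next
  assume *: "\<forall>u\<in>mspace m. R i (f u) (k u)"
  have "R i (f u) v \<longleftrightarrow> R i (k u) v" if "u \<in> mspace m" for u v
    using R_trans[of i "f u" "k u" v] R_trans[of i "k u" "f u" v] R_sym[of i "f u" "k u"] * that
    by blast
  then show "coset_at f i = coset_at k i"
    by (simp add: coset_at_def)
qed

section \<open>The limit core, and the discriminant group as a part of it\<close>

lemma limit_core_carrier:
  "carrier (limit_core G Gs) = {s. \<forall>i. s i \<in> rcosets (core i) \<and> s (Suc i) \<subseteq> s i}"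
proof -
  have ref: "\<exists>B\<in>rcosets (core i). A \<subseteq> B" if A: "A \<in> rcosets (core (Suc i))" for A i
  proof -
    obtain a where "a \<in> carrier G" "A = core (Suc i) #> a"
      using A by (auto simp: RCOSETS_def)
    then show ?thesis
      using core_Suc[of i] by (auto simp: RCOSETS_def r_coset_def intro!: bexI[of _ a])
  qed
  have "limit_core_quotient G Gs = (\<lambda>i. G Mod core i)"
    by (simp add: fun_eq_iff limit_core_quotient_def)
  then show ?thesis
    using carrier_inverse_limit_cosets[of "\<lambda>_. G" core] ref core_normal
    by (simp add: limit_core_def normal_imp_subgroup)
qed

text \<open>Since \<open>core i\<close> lies in \<open>Gs i\<close>, a coset with a representative
  in \<open>Gs i\<close> stays inside \<open>Gs i\<close>. The quotients of the chain thus consist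
  of the same sets as those of \<open>G\<close>, and no embedding is involved.\<close>

lemma rcosets_Gs:
  "rcosets\<^bsub>G\<lparr>carrier := Gs i\<rparr>\<^esub> core i = {A \<in> rcosets (core i). A \<subseteq> Gs i}"
proof -
  interpret N: normal "core i" G by (rule core_normal)
  interpret S: subgroup "Gs i" G by (rule Gs_subgroup)
  have "core i #> a \<subseteq> Gs i" if "a \<in> Gs i" for a
    using that core_subset_Gs[of i] by (auto simp: r_coset_def)
  moreover have "a \<in> Gs i" if "a \<in> carrier G" "core i #> a \<subseteq> Gs i" for a
    using that G.rcos_self N.subgroup_axioms by blast
  moreover have "rcosets\<^bsub>G\<lparr>carrier := Gs i\<rparr>\<^esub> core i = (\<lambda>a. core i #> a) ` Gs i"
    by (auto simp: RCOSETS_def r_coset_def)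
  ultimately show ?thesis
    using S.subset by (auto simp: RCOSETS_def)
qed

lemma discriminant_group_carrier:
  "carrier (discriminant_group G Gs) = {s \<in> carrier (limit_core G Gs). \<forall>i. s i \<subseteq> Gs i}"
proof -
  have ref: "\<exists>B\<in>rcosets\<^bsub>G\<lparr>carrier := Gs i\<rparr>\<^esub> (core i). A \<subseteq> B"
    if A: "A \<in> rcosets\<^bsub>G\<lparr>carrier := Gs (Suc i)\<rparr>\<^esub> (core (Suc i))" for A i
  proof -
    obtain a where "a \<in> Gs (Suc i)" "A = core (Suc i) #> a"
      using A by (auto simp: RCOSETS_def r_coset_def)
    then show ?thesis
      using core_Suc[of i] Gs_Suc[of i] by (auto simp: RCOSETS_def r_coset_def intro!: bexI[of _ a])
  qed
  have "discriminant_quotient G Gs = (\<lambda>i. G\<lparr>carrier := Gs i\<rparr> Mod core i)"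
    by (simp add: fun_eq_iff discriminant_quotient_def)
  moreover have "subgroup (core i) (G\<lparr>carrier := Gs i\<rparr>)" for i
    using core_normal core_subset_Gs Gs_subgroup by (simp add: G.subgroup_incl normal_imp_subgroup)
  ultimately have "carrier (discriminant_group G Gs) =
      {s. \<forall>i. s i \<in> rcosets\<^bsub>G\<lparr>carrier := Gs i\<rparr>\<^esub> (core i) \<and> s (Suc i) \<subseteq> s i}"
    using carrier_inverse_limit_cosets[of "\<lambda>i. G\<lparr>carrier := Gs i\<rparr>" core] ref
    by (simp add: discriminant_group_def G.subgroup_imp_group Gs_subgroup)
  then show ?thesis
    by (auto simp: limit_core_carrier rcosets_Gs)
qed

text \<open>Products of cosets and the unit coset do not mention the carrier, so the two records
  differ in that field alone.\<close>

lemma discriminant_group_eq: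
  "discriminant_group G Gs = limit_core G Gs\<lparr>carrier := carrier (discriminant_group G Gs)\<rparr>"
  by (simp add: discriminant_group_def limit_core_def inverse_limit_def product_group_def
      discriminant_quotient_def limit_core_quotient_def FactGroup_def set_mult_def)

lemma discriminant_topology_eq:
  "discriminant_topology G Gs =
     subtopology (limit_core_topology G Gs) (carrier (discriminant_group G Gs))"
  unfolding discriminant_topology_def limit_core_topology_def discriminant_group_def
  by (rule inverse_limit_topology_subset)
    (use discriminant_group_carrier in \<open>auto simp: discriminant_group_def limit_core_def\<close>)

lemma topological_group_limit_core:
  "topological_group (limit_core G Gs) (limit_core_topology G Gs)"
  unfolding limit_core_def limit_core_topology_def
  by (rule topological_group_inverse_limit)
    (simp_all add: limit_core_quotient_def normal.factorgroup_is_group[OF core_normal]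
      G.coset_bond_hom core_normal core_Suc)

section \<open>Surjectivity by compactness, and the group isomorphism\<close>

lemma cells_limit_exists:
  assumes g: "\<And>i. g i \<in> carrier G" and u: "u \<in> mspace m"
    and coh: "\<And>i. R i (\<Phi> (g (Suc i)) u) (\<Phi> (g i) u)"
  shows "\<exists>v. \<forall>i. R i v (\<Phi> (g i) u)"
proof -
  interpret M: Metric_space "mspace m" "mdist m" by simp
  define C where "C i = {v. R i v (\<Phi> (g i) u)}" for i
  have "decseq C"
    by (rule decseq_SucI) (auto simp: C_def intro: R_trans[OF R_Suc coh])
  moreover have "C i \<noteq> {}" for i
    using R_refl act_closed[OF g u] by (auto simp: C_def)
  moreover have "closedin M.mtopology (C i)" for i
    using closedin_R by (simp add: C_def mtopology_of_def)
  ultimately have "\<Inter>(range C) \<noteq> {}"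
    using compact unfolding mtopology_of_def M.compact_space_nest by blast
  then show ?thesis
    by (auto simp: C_def)
qed

text \<open>The same compactness argument serves twice, for \<open>g\<close> and for the inverses;
  the two maps so obtained are mutually inverse because the relations separate points.\<close>

lemma limit_map_exists:
  assumes g: "\<And>i. g i \<in> carrier G"
    and coh: "\<And>i u. u \<in> mspace m \<Longrightarrow> R i (\<Phi> (g (Suc i)) u) (\<Phi> (g i) u)"
  shows "\<exists>f\<in>limit_maps. \<forall>i. g i \<in> coset_at f i"
proof -
  have inv_g: "inv (g i) \<in> carrier G" for i
    using g by simp
  have inv_coh: "R i (\<Phi> (inv (g (Suc i))) u) (\<Phi> (inv (g i)) u)" if u: "u \<in> mspace m" for i u
  proof -
    \<comment> \<open>Coherence at \<open>w\<close> relates \<open>u\<close> to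
      \<open>\<Phi> (g i) w\<close>; applying \<open>inv (g i)\<close> gives coherence of the
      inverses.\<close>
    define w where "w = \<Phi> (inv (g (Suc i))) u"
    have "w \<in> mspace m" "\<Phi> (g (Suc i)) w = u"
      using act_closed[OF inv_g u] g u by (auto simp: w_def)
    then have "R i (\<Phi> (inv (g i)) u) w"
      using R_act[OF inv_g coh[of w i], of i] g by simp
    then show ?thesis
      unfolding w_def by (rule R_sym)
  qed
  have "\<exists>f. \<forall>u\<in>mspace m. \<forall>i. R i (f u) (\<Phi> (g i) u)"
    using cells_limit_exists[OF g _ coh] by (intro bchoice) blast
  then obtain f where f: "\<And>u i. u \<in> mspace m \<Longrightarrow> R i (f u) (\<Phi> (g i) u)"
    by blast
  have "\<exists>f'. \<forall>u\<in>mspace m. \<forall>i. R i (f' u) (\<Phi> (inv (g i)) u)"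
    using cells_limit_exists[OF inv_g _ inv_coh] by (intro bchoice) blast
  then obtain f' where f': "\<And>u i. u \<in> mspace m \<Longrightarrow> R i (f' u) (\<Phi> (inv (g i)) u)"
    by blast
  have clo: "f u \<in> mspace m" "f' u \<in> mspace m" if "u \<in> mspace m" for u
    using f[OF that] f'[OF that] R_mspace by blast+
  have "f' (f u) = u" if u: "u \<in> mspace m" for u
  proof (rule R_separates)
    fix i
    have "R i (\<Phi> (inv (g i)) (f u)) u"
      using R_act[OF inv_g f[OF u], of i i] g u by simp
    then show "R i (f' (f u)) u"
      by (rule R_trans[OF f'[OF clo(1)[OF u]]])
  qed
  moreover have "f (f' u) = u" if u: "u \<in> mspace m" for u
  proof (rule R_separates)
    fix i
    have "R i (\<Phi> (g i) (f' u)) u"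
      using R_act[OF g f'[OF u], of i i] g u by simp
    then show "R i (f (f' u)) u"
      by (rule R_trans[OF f[OF clo(2)[OF u]]])
  qed
  ultimately have "bij_betw f (mspace m) (mspace m)"
    using clo by (intro bij_betw_byWitness[where f' = f']) auto
  \<comment> \<open>The choice left \<open>f\<close> arbitrary outside the space; \<open>Bij\<close>
    demands an extensional map.\<close>
  then have "bij_betw (restrict f (mspace m)) (mspace m) (mspace m)"
    by (rule bij_betw_cong[THEN iffD1, rotated]) simp
  then have "restrict f (mspace m) \<in> Bij (mspace m)"
    by (simp add: Bij_def)
  moreover have "g i \<in> coset_at (restrict f (mspace m)) i" for i
    using f g by (simp add: coset_at_def)
  ultimately show ?thesis
    by (intro bexI[of _ "restrict f (mspace m)"]) (auto simp: limit_maps_def)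
qed

lemma bij_betw_coset_at: "bij_betw coset_at limit_maps (carrier (limit_core G Gs))"
proof (rule bij_betw_imageI)
  show "inj_on coset_at limit_maps"
  proof (rule inj_onI)
    fix f k assume f: "f \<in> limit_maps" and k: "k \<in> limit_maps" and eq: "coset_at f = coset_at k"
    have "f u = k u" if "u \<in> mspace m" for u
      using coset_at_eq_iff[OF f k] eq that by (intro R_separates) simp
    then show "f = k"
      using f k by (auto simp: limit_maps_def dest!: Bij_imp_extensional intro: extensionalityI)
  qed
  show "coset_at ` limit_maps = carrier (limit_core G Gs)"
  proof (intro subset_antisym subsetI)
    fix s assume "s \<in> coset_at ` limit_maps"
    then obtain f where f: "f \<in> limit_maps" "s = coset_at f" by blast
    have "coset_at f i \<in> rcosets (core i)" for i
      using coset_at_nonempty[OF f(1), of i] coset_at_eq[of _ f i] coset_atD(1)[of _ f i]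
      by (auto simp: RCOSETS_def)
    moreover have "coset_at f (Suc i) \<subseteq> coset_at f i" for i
      by (auto simp: coset_at_def intro: R_Suc)
    ultimately show "s \<in> carrier (limit_core G Gs)"
      by (simp add: f(2) limit_core_carrier)
  next
    fix s assume "s \<in> carrier (limit_core G Gs)"
    then have s: "\<And>i. s i \<in> rcosets (core i)" "\<And>i. s (Suc i) \<subseteq> s i"
      by (auto simp: limit_core_carrier)
    have "\<exists>g. g \<in> carrier G \<and> s i = core i #> g" for i
      using s(1)[of i] by (auto simp: RCOSETS_def)
    then obtain g where g: "\<And>i. g i \<in> carrier G" "\<And>i. s i = core i #> g i"
      by metis
    \<comment> \<open>Compatibility becomes coherence: \<open>g (Suc i)\<close> lies in
      \<open>s (Suc i)\<close>, hence in \<open>s i\<close>, hence approximates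
      \<open>\<Phi> (g i)\<close> at level \<open>i\<close>.\<close>
    have coset: "coset_at (\<Phi> (g i)) i = s i" for i
      using coset_at_act[OF g(1)[of i], of i] normal.coset_eq[OF core_normal, of i] g[of i] by auto
    have mem: "g i \<in> s i" for i
      using g G.rcos_self[OF _ normal_imp_subgroup[OF core_normal]] by simp
    have "R i (\<Phi> (g (Suc i)) u) (\<Phi> (g i) u)" if "u \<in> mspace m" for i u
      using coset_atD(2)[of "g (Suc i)" "\<Phi> (g i)" i u] coset[of i] mem[of "Suc i"] s(2)[of i] that
        R_sym[of i "\<Phi> (g i) u" "\<Phi> (g (Suc i)) u"] by blast
    then obtain f where f: "f \<in> limit_maps" "\<And>i. g i \<in> coset_at f i"
      using limit_map_exists g(1) by blast
    then have "coset_at f = s"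
      using coset_at_eq g(2) by (simp add: fun_eq_iff)
    then show "s \<in> coset_at ` limit_maps"
      using f(1) by blast
  qed
qed

text \<open>Products in the limit core are taken coset by coset, and a product of cosets of a normal
  subgroup is the coset of the product of any representatives.\<close>

lemma coset_at_iso: "coset_at \<in> iso (closure_group m G \<Phi>) (limit_core G Gs)"
proof -
  have carr: "carrier (closure_group m G \<Phi>) = limit_maps"
    by (simp add: closure_group_eq)
  have "coset_at (f \<otimes>\<^bsub>closure_group m G \<Phi>\<^esub> k) = coset_at f \<otimes>\<^bsub>limit_core G Gs\<^esub> coset_at k"
    if f: "f \<in> limit_maps" and k: "k \<in> limit_maps" for f k
  proof
    fix i
    obtain g h where g: "g \<in> coset_at f i" and h: "h \<in> coset_at k i"
      using coset_at_nonempty f k by blast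
    have "coset_at (compose (mspace m) f k) i = core i #> (g \<otimes> h)"
      using coset_at_eq[OF coset_at_compose[OF f k g h]] .
    also have "\<dots> = coset_at f i <#> coset_at k i"
      using normal.rcos_sum[OF core_normal coset_atD(1)[OF g] coset_atD(1)[OF h]]
        coset_at_eq[OF g] coset_at_eq[OF h] by simp
    finally show "coset_at (f \<otimes>\<^bsub>closure_group m G \<Phi>\<^esub> k) i =
        (coset_at f \<otimes>\<^bsub>limit_core G Gs\<^esub> coset_at k) i"
      by (simp add: closure_group_mult[OF f k] limit_core_def limit_core_quotient_def FactGroup_def)
  qed
  then show ?thesis
    using bij_betw_coset_at by (auto simp: iso_def hom_def carr bij_betw_def)
qed

section \<open>Matching the topologies, and restriction to the isotropy group\<close>

lemma openin_closure_group:
  "openin (subtopology (uniform_topology m) limit_maps) U \<longleftrightarrow>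
     U \<subseteq> limit_maps \<and>
     (\<forall>f\<in>U. \<exists>i. \<forall>k\<in>limit_maps. coset_at k i = coset_at f i \<longrightarrow> k \<in> U)"
proof -
  interpret U: Metric_space "carrier (Homeo m)" "uniform_dist m"
    using Metric_space_uniform_dist compact base by blast
  interpret K: Submetric "carrier (Homeo m)" "uniform_dist m" limit_maps
    using limit_maps_Homeo by unfold_locales auto
  \<comment> \<open>Balls around \<open>f\<close> and sets of maps sharing a coset with
    \<open>f\<close> refine each other, so the metric disappears from the description.\<close>
  have "(\<exists>r>0. K.sub.mball f r \<subseteq> U) \<longleftrightarrow>
      (\<exists>i. \<forall>k\<in>limit_maps. coset_at k i = coset_at f i \<longrightarrow> k \<in> U)"
    if f: "f \<in> limit_maps" for f
  proof
    assume "\<exists>r>0. K.sub.mball f r \<subseteq> U"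
    then obtain r where r: "r > 0" "\<And>k. \<lbrakk>k \<in> limit_maps; uniform_dist m f k < r\<rbrakk> \<Longrightarrow> k \<in> U"
      using f by (auto simp: subset_iff)
    obtain i where i: "\<forall>f k. (\<forall>u\<in>mspace m. R i (f u) (k u)) \<longrightarrow> uniform_dist m f k < r"
      using R_imp_uniform_dist[OF r(1)] by blast
    have "k \<in> U" if "k \<in> limit_maps" "coset_at k i = coset_at f i" for k
      using that i r(2) coset_at_eq_iff[OF f that(1), of i] by simp
    then show "\<exists>i. \<forall>k\<in>limit_maps. coset_at k i = coset_at f i \<longrightarrow> k \<in> U"
      by blast
  next
    assume "\<exists>i. \<forall>k\<in>limit_maps. coset_at k i = coset_at f i \<longrightarrow> k \<in> U"
    then obtain i where i: "\<And>k. \<lbrakk>k \<in> limit_maps; coset_at k i = coset_at f i\<rbrakk> \<Longrightarrow> k \<in> U"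
      by blast
    obtain \<delta> where "\<delta> > 0" and \<delta>: "\<forall>f\<in>carrier (Homeo m). \<forall>k\<in>carrier (Homeo m).
        uniform_dist m f k < \<delta> \<longrightarrow> (\<forall>u\<in>mspace m. R i (f u) (k u))"
      using uniform_dist_imp_R by blast
    have "k \<in> U" if "k \<in> limit_maps" "uniform_dist m f k < \<delta>" for k
      using \<delta>[rule_format, OF limit_maps_Homeo[OF f] limit_maps_Homeo[OF that(1)] that(2)]
        coset_at_eq_iff[OF f that(1), of i] i[OF that(1)] by simp
    then show "\<exists>r>0. K.sub.mball f r \<subseteq> U"
      using \<open>\<delta> > 0\<close> by (intro exI[of _ \<delta>]) auto
  qed
  then show ?thesis
    unfolding uniform_topology_def K.mtopology_submetric[symmetric] K.sub.openin_mtopology by blast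
qed

lemma topspace_closure_group:
  "topspace (subtopology (uniform_topology m) limit_maps) = limit_maps"
proof -
  have "openin (subtopology (uniform_topology m) limit_maps) limit_maps"
    by (simp add: openin_closure_group)
  from openin_subset[OF this] show ?thesis
    by (auto simp: topspace_subtopology)
qed

text \<open>Both topologies declare a set open by the same condition on agreement at one index. The
  bijection carries one condition onto the other, which yields both continuities at once.\<close>

lemma coset_at_homeomorphic:
  "homeomorphic_map (subtopology (uniform_topology m) limit_maps) (limit_core_topology G Gs) coset_at"
proof (rule homeomorphic_map_iff_openin)
  note top = topspace_closure_group
  show "bij_betw coset_at (topspace (subtopology (uniform_topology m) limit_maps))
      (topspace (limit_core_topology G Gs))"
    using bij_betw_coset_at by (simp only: top) (simp add: limit_core_topology_def limit_core_def)
  have img: "coset_at ` limit_maps = carrier (limit_core G Gs)"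
    and inj: "inj_on coset_at limit_maps"
    using bij_betw_coset_at by (auto simp: bij_betw_def)
  fix U assume "U \<subseteq> topspace (subtopology (uniform_topology m) limit_maps)"
  then have U: "U \<subseteq> limit_maps"
    by (simp only: top)
  then have "k \<in> U \<longleftrightarrow> coset_at k \<in> coset_at ` U" if "k \<in> limit_maps" for k
    using that inj by (simp add: inj_on_image_mem_iff)
  then show "openin (limit_core_topology G Gs) (coset_at ` U) \<longleftrightarrow>
      openin (subtopology (uniform_topology m) limit_maps) U"
    using U unfolding openin_closure_group limit_core_topology_def openin_inverse_limit_topology
      limit_core_def[symmetric] img[symmetric] by auto
qed

lemma closure_group_iso:
  "topological_group_iso (closure_group m G \<Phi>)
     (subtopology (uniform_topology m) (carrier (closure_group m G \<Phi>)))
     (limit_core G Gs) (limit_core_topology G Gs) coset_at"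
proof -
  have carr: "carrier (closure_group m G \<Phi>) = limit_maps"
    by (simp add: closure_group_eq)
  show ?thesis
    using topspace_closure_group topological_group_transport[OF group_closure_group _ topological_group_limit_core
        coset_at_iso coset_at_homeomorphic]
      coset_at_iso coset_at_homeomorphic topological_group_limit_core
    by (simp add: topological_group_iso_def carr)
qed

lemma fixes_base_iff:
  assumes f: "f \<in> limit_maps"
  shows "f x = x \<longleftrightarrow> (\<forall>i. coset_at f i \<subseteq> Gs i)"
proof
  assume "f x = x"
  then show "\<forall>i. coset_at f i \<subseteq> Gs i"
    using base by (auto simp: coset_at_def Gs_eq R_sym)
next
  assume *: "\<forall>i. coset_at f i \<subseteq> Gs i"
  show "f x = x"
  proof (rule R_separates)
    fix i
    obtain g where g: "g \<in> coset_at f i"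
      using coset_at_nonempty[OF f] by blast
    then have "R i (\<Phi> g x) x"
      using * by (auto simp: Gs_eq)
    then show "R i (f x) x"
      by (rule R_trans[OF coset_atD(2)[OF g base]])
  qed
qed

lemma isotropy_group_iso:
  "topological_group_iso (isotropy_group m G \<Phi> x)
     (subtopology (uniform_topology m) (carrier (isotropy_group m G \<Phi> x)))
     (discriminant_group G Gs) (discriminant_topology G Gs) coset_at"
proof -
  interpret K: group "closure_group m G \<Phi>"
    by (rule group_closure_group)
  define S where "S = {f \<in> limit_maps. f x = x}"
  have carr: "carrier (closure_group m G \<Phi>) = limit_maps"
    by (simp add: closure_group_eq)
  have S: "subgroup S (closure_group m G \<Phi>)"
  proof (rule K.subgroupI)
    show "S \<subseteq> carrier (closure_group m G \<Phi>)"
      by (auto simp: S_def carr)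
    show "S \<noteq> {}"
      using act_limit_maps[OF G.one_closed] base by (auto simp: S_def)
    show mult: "f \<otimes>\<^bsub>closure_group m G \<Phi>\<^esub> k \<in> S" if "f \<in> S" "k \<in> S" for f k
      using that K.m_closed[of f k] base
      by (auto simp: S_def carr closure_group_mult compose_eq)
    show "inv\<^bsub>closure_group m G \<Phi>\<^esub> f \<in> S" if f: "f \<in> S" for f
    proof -
      let ?k = "inv\<^bsub>closure_group m G \<Phi>\<^esub> f"
      have fK: "f \<in> limit_maps" "f x = x" and k: "?k \<in> limit_maps"
        using f K.inv_closed[of f] by (auto simp: S_def carr)
      \<comment> \<open>An idempotent of a group is its unit; this identifies the unit of the
        closure as \<open>\<Phi> \<one>\<close>, whose values are known.\<close>
      have "\<Phi> \<one> \<in> limit_maps" "\<Phi> \<one> \<otimes>\<^bsub>closure_group m G \<Phi>\<^esub> \<Phi> \<one> = \<Phi> \<one>"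
        using act_limit_maps[OF G.one_closed]
        by (auto simp: closure_group_mult id_eq_one[symmetric] compose_def)
      then have "\<one>\<^bsub>closure_group m G \<Phi>\<^esub> = \<Phi> \<one>"
        using K.r_cancel_one' [of "\<Phi> \<one>" "\<Phi> \<one>"] by (simp add: carr)
      then have "compose (mspace m) ?k f = \<Phi> \<one>"
        using closure_group_mult[OF k fK(1)] K.l_inv[of f] fK(1) by (simp add: carr)
      then have "?k x = x"
        using fK(2) base by (metis act_one compose_eq)
      then show ?thesis
        using k by (simp add: S_def)
    qed
  qed
  have img: "coset_at ` S = carrier (discriminant_group G Gs)"
    using bij_betw_imp_surj_on[OF bij_betw_coset_at, symmetric] fixes_base_iff
    by (auto simp: S_def discriminant_group_carrier)
  have "isotropy_group m G \<Phi> x = closure_group m G \<Phi>\<lparr>carrier := S\<rparr>"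
    by (simp add: isotropy_group_def carr S_def) (simp add: closure_group_eq)
  \<comment> \<open>Restricting in two steps through \<open>limit_maps\<close> gives the direct
    subspace topology of the statement.\<close>
  moreover have "limit_maps \<inter> S = S"
    by (auto simp: S_def)
  then have "subtopology (subtopology (uniform_topology m) limit_maps) S =
      subtopology (uniform_topology m) S"
    by (simp add: subtopology_subtopology)
  ultimately show ?thesis
    using topological_group_iso_subgroup[OF closure_group_iso S] discriminant_group_eq
    by (simp add: img discriminant_topology_eq carr)
qed

end

section \<open>The relations of a group chain\<close>

lemma cantor_set_imp_compact_space: "cantor_set m \<Longrightarrow> compact_space (mtopology_of m)"
  using homeomorphic_compact_space[of "mtopology_of m" cantor_topology]
  by (simp add: cantor_set_def cantor_topology_def compact_space_product_topology
      compact_space_discrete_topology)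

text \<open>The relation "in a common translate of \<open>V i\<close>" is an equivalence since
  translates that meet coincide, and is invariant since \<open>G\<close> permutes the
  translates.\<close>

lemma associated_chain_invariant_cells:
  assumes compact: "compact_space (mtopology_of m)"
    and act: "action_by_homeos m G \<Phi>"
    and x: "x \<in> mspace m"
    and chain: "associated_group_chain m G \<Phi> x Gs"
  shows "\<exists>R. invariant_cells m G \<Phi> R x Gs"
proof -
  interpret M: Metric_space "mspace m" "mdist m" by simp
  interpret act: group_action G "mspace m" \<Phi>
    using act by (simp add: action_by_homeos_def)
  interpret G: group G
    using act.group_hom by (simp add: group_hom_def)
  obtain V where V_Suc: "\<forall>i. V (Suc i) \<subseteq> V i"
    and V_clopen: "\<forall>i. openin (mtopology_of m) (V i) \<and> closedin (mtopology_of m) (V i)"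
    and V_Int: "(\<Inter>i. V i) = {x}"
    and V_part: "\<forall>i. finite ((\<lambda>g. \<Phi> g ` V i) ` carrier G) \<and>
      partition_on (mspace m) ((\<lambda>g. \<Phi> g ` V i) ` carrier G)"
    and V_diam: "\<forall>i\<ge>1. \<forall>g\<in>carrier G. mdiameter m (\<Phi> g ` V i) < (1/2) ^ i"
    and V_Gs: "\<forall>i. Gs i = {g \<in> carrier G. \<Phi> g ` V i = V i}"
    using chain unfolding associated_group_chain_def by (elim conjE exE) (rule that)
  note V_Suc = V_Suc[rule_format] and Gs = V_Gs[rule_format]
    and diam = V_diam[rule_format]
    and V_open = V_clopen[rule_format, THEN conjunct1] and part = V_part[rule_format, THEN conjunct2]
  define R where "R i u v \<longleftrightarrow> (\<exists>h\<in>carrier G. u \<in> \<Phi> h ` V i \<and> v \<in> \<Phi> h ` V i)" for i u v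
  have xV: "x \<in> V i" for i
    using V_Int by blast
  have cells_sub: "\<Phi> h ` V i \<subseteq> mspace m" if "h \<in> carrier G" for h i
    using partition_onD1[OF part[of i]] that by blast
  have V_sub: "V i \<subseteq> mspace m" for i
    using openin_subset[OF V_open[of i]] by simp
  have one: "\<Phi> \<one>\<^bsub>G\<^esub> ` V i = V i" for i
  proof -
    have "\<Phi> \<one>\<^bsub>G\<^esub> u = u" if "u \<in> V i" for u
      using that V_sub act.id_eq_one by (metis restrict_apply' subsetD)
    then show ?thesis by simp
  qed
  have cell_eq: "\<Phi> h ` V i = \<Phi> k ` V i"
    if "h \<in> carrier G" "k \<in> carrier G" "u \<in> \<Phi> h ` V i" "u \<in> \<Phi> k ` V i" for h k u i
    using disjointD[OF partition_onD2[OF part[of i]], of "\<Phi> h ` V i" "\<Phi> k ` V i"] that by blast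
  have cell_mult: "\<Phi> g ` \<Phi> h ` V i = \<Phi> (g \<otimes>\<^bsub>G\<^esub> h) ` V i"
    if "g \<in> carrier G" "h \<in> carrier G" for g h i
    using act.composition_rule[OF _ that] V_sub[of i] by (force simp: image_image)
  have cover: "\<exists>h\<in>carrier G. u \<in> \<Phi> h ` V i" if "u \<in> mspace m" for u i
    using partition_onD1[OF part[of i]] that by blast
  have cell_open: "openin M.mtopology (\<Phi> h ` V i)" if "h \<in> carrier G" for h i
    using act that homeomorphic_imp_open_map V_open[of i]
    unfolding action_by_homeos_def mtopology_of_def open_map_def by blast
  have R_mspace: "u \<in> mspace m" if "R i u v" for i u v
    using that cells_sub unfolding R_def by blast
  have R_refl: "R i u u" if "u \<in> mspace m" for i u
    using cover[OF that] unfolding R_def by blast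
  have R_sym: "R i v u" if "R i u v" for i u v
    using that unfolding R_def by blast
  have R_trans: "R i u w" if uv: "R i u v" and vw: "R i v w" for i u v w
  proof -
    obtain h k where "h \<in> carrier G" "u \<in> \<Phi> h ` V i" "v \<in> \<Phi> h ` V i"
      "k \<in> carrier G" "v \<in> \<Phi> k ` V i" "w \<in> \<Phi> k ` V i"
      using uv vw unfolding R_def by blast
    then show ?thesis
      using cell_eq[of h k v i] unfolding R_def by blast
  qed
  have R_Suc: "R i u v" if uv: "R (Suc i) u v" for i u v
  proof -
    obtain h where "h \<in> carrier G" "u \<in> \<Phi> h ` V (Suc i)" "v \<in> \<Phi> h ` V (Suc i)"
      using uv unfolding R_def by blast
    moreover have "\<Phi> h ` V (Suc i) \<subseteq> \<Phi> h ` V i"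
      by (rule image_mono[OF V_Suc])
    ultimately show ?thesis
      unfolding R_def by (intro bexI[of _ h]) auto
  qed
  have R_act: "R i (\<Phi> g u) (\<Phi> g v)" if g: "g \<in> carrier G" and "R i u v" for i g u v
  proof -
    obtain h where h: "h \<in> carrier G" "u \<in> \<Phi> h ` V i" "v \<in> \<Phi> h ` V i"
      using \<open>R i u v\<close> unfolding R_def by blast
    have "\<Phi> g u \<in> \<Phi> (g \<otimes>\<^bsub>G\<^esub> h) ` V i" "\<Phi> g v \<in> \<Phi> (g \<otimes>\<^bsub>G\<^esub> h) ` V i"
      unfolding cell_mult[OF g h(1), of i, symmetric] using h(2,3) by (simp_all add: imageI)
    then show ?thesis
      unfolding R_def by (intro bexI[OF _ G.m_closed[OF g h(1)]] conjI)
  qed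
  have R_open: "\<exists>\<delta>>0. \<forall>u\<in>mspace m. \<forall>v\<in>mspace m. mdist m u v < \<delta> \<longrightarrow> R i u v" for i
  proof -
    \<comment> \<open>The translates form an open cover of a compact space; a Lebesgue number gives
      one radius for all points.\<close>
    have "\<exists>\<epsilon>>0. \<forall>u\<in>mspace m. \<exists>U\<in>(\<lambda>g. \<Phi> g ` V i) ` carrier G. M.mball u \<epsilon> \<subseteq> U"
    proof (rule M.lebesgue_number)
      show "compactin M.mtopology (mspace m)"
        using compact by (simp add: compact_space_def mtopology_of_def)
    qed (use partition_onD1[OF part[of i]] cell_open in auto)
    then obtain \<epsilon> where "\<epsilon> > 0"
      and \<epsilon>: "\<And>u. u \<in> mspace m \<Longrightarrow> \<exists>g\<in>carrier G. M.mball u \<epsilon> \<subseteq> \<Phi> g ` V i"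
      by blast
    have "R i u v" if "u \<in> mspace m" "v \<in> mspace m" "mdist m u v < \<epsilon>" for u v
    proof -
      have "u \<in> M.mball u \<epsilon>" "v \<in> M.mball u \<epsilon>"
        using that \<open>\<epsilon> > 0\<close> by auto
      then show ?thesis
        using \<epsilon>[OF that(1)] unfolding R_def by blast
    qed
    then show ?thesis
      using \<open>\<epsilon> > 0\<close> by blast
  qed
  have R_orbit: "\<exists>h\<in>carrier G. R i u (\<Phi> h x)" if "u \<in> mspace m" for i u
    using cover[OF that, of i] xV[of i] unfolding R_def by blast
  have Gs_eq: "Gs i = {g \<in> carrier G. R i (\<Phi> g x) x}" for i
  proof -
    have "\<Phi> g ` V i = V i \<longleftrightarrow> R i (\<Phi> g x) x" if g: "g \<in> carrier G" for g
    proof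
      assume "\<Phi> g ` V i = V i"
      then have "\<Phi> g x \<in> \<Phi> \<one>\<^bsub>G\<^esub> ` V i" "x \<in> \<Phi> \<one>\<^bsub>G\<^esub> ` V i"
        using xV[of i] imageI[OF xV[of i], of "\<Phi> g"] by (simp_all add: one)
      then show "R i (\<Phi> g x) x"
        unfolding R_def by (intro bexI[OF _ G.one_closed] conjI)
    next
      assume "R i (\<Phi> g x) x"
      then obtain h where h: "h \<in> carrier G" "\<Phi> g x \<in> \<Phi> h ` V i" "x \<in> \<Phi> h ` V i"
        unfolding R_def by blast
      \<comment> \<open>Translates sharing a point are equal: \<open>x\<close> identifies the
        translate by \<open>h\<close> with \<open>V i\<close>, viewed as the translate by the unit,
        and \<open>\<Phi> g x\<close> identifies it with the translate by \<open>g\<close>.\<close>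
      have "\<Phi> h ` V i = V i"
        using cell_eq[OF h(1) G.one_closed h(3)] one[of i] xV[of i] by simp
      moreover have "\<Phi> g ` V i = \<Phi> h ` V i"
        by (rule cell_eq[OF g h(1) imageI[OF xV] h(2)])
      ultimately show "\<Phi> g ` V i = V i"
        by simp
    qed
    then show ?thesis
      unfolding Gs by blast
  qed
  have R_small: "\<exists>i. \<forall>u v. R i u v \<longrightarrow> mdist m u v < e" if "e > 0" for e
  proof -
    obtain n where n: "(1/2) ^ n < e"
      using real_arch_pow_inv[of e "1/2"] \<open>e > 0\<close> by auto
    \<comment> \<open>The diameter bound starts at index 1, hence \<open>Suc n\<close> instead of
      \<open>n\<close>.\<close>
    have "mdist m u v < e" if uv: "R (Suc n) u v" for u v
    proof -
      obtain h where h: "h \<in> carrier G" "u \<in> \<Phi> h ` V (Suc n)" "v \<in> \<Phi> h ` V (Suc n)"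
        using uv unfolding R_def by blast
      have "mdist m u v \<le> mdiameter m (\<Phi> h ` V (Suc n))"
        by (rule mdist_le_mdiameter[OF compact cells_sub[OF h(1)] h(2,3)])
      also have "\<dots> < (1/2) ^ Suc n"
        by (rule diam) (simp_all add: h(1))
      also have "\<dots> \<le> (1/2) ^ n"
        by simp
      finally show ?thesis
        using n by simp
    qed
    then show ?thesis
      by blast
  qed
  have "invariant_cells m G \<Phi> R x Gs"
    using act.group_action_axioms compact x R_mspace R_refl R_sym R_trans R_Suc R_act R_open R_small
      R_orbit Gs_eq
    by (intro invariant_cells.intro invariant_cells_axioms.intro)
  then show ?thesis
    by (rule exI[of _ R])
qed

theorem theorem1p8:
  fixes m :: "'a metric" and G :: "('g, 'r) monoid_scheme"
    and \<Phi> :: "'g \<Rightarrow> 'a \<Rightarrow> 'a" and x :: 'a and Gs :: "nat \<Rightarrow> 'g set"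
  assumes "cantor_set m"
    and "finitely_generated_group G" and "infinite (carrier G)"
    and "action_by_homeos m G \<Phi>"
    and "minimal_action m G \<Phi>"
    and "equicontinuous_action m G \<Phi>"
    and "x \<in> mspace m"
    and "associated_group_chain m G \<Phi> x Gs"
  shows "\<exists>\<Theta> :: ('a \<Rightarrow> 'a) \<Rightarrow> (nat \<Rightarrow> 'g set).
      topological_group_iso
        (closure_group m G \<Phi>)
        (subtopology (uniform_topology m) (carrier (closure_group m G \<Phi>)))
        (limit_core G Gs) (limit_core_topology G Gs) \<Theta> \<and>
      (\<forall>g \<in> carrier G. \<Theta> (\<Phi> g) = (\<lambda>i. g <#\<^bsub>G\<^esub> chain_core G Gs i)) \<and>
      topological_group_iso
        (isotropy_group m G \<Phi> x)
        (subtopology (uniform_topology m) (carrier (isotropy_group m G \<Phi> x)))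
        (discriminant_group G Gs) (discriminant_topology G Gs) \<Theta>"
proof -
  obtain R where "invariant_cells m G \<Phi> R x Gs"
    using associated_chain_invariant_cells[OF cantor_set_imp_compact_space[OF assms(1)] assms(4,7,8)]
    by blast
  then interpret invariant_cells m G \<Phi> R x Gs .
  show ?thesis
    \<comment> \<open>The common witness for all three clauses is \<open>coset_at\<close>.\<close>
    using closure_group_iso isotropy_group_iso coset_at_act by blast
qed

end
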